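(* Let $G=(V,E)$ be a simple graph with $n$ vertices, given as an edge stream, let $\epsilon>0$, $\delta\in(0,1)$ and $c>0$ be a constant. Consider the following algorithm. Set $\prec$ to be an empty list, $U\gets V$, $\hat\epsilon\gets\frac{\epsilon}{4+3\epsilon}$, $\Delta\gets n-1$, $K\gets1+\epsilon$, $T\gets\log_{1+\epsilon/2}n$, and $q\gets\lfloor\log_{1+\epsilon/2}n^c\rfloor$, $i\gets q$. While $U\ne\emptyset$: (1) if $i=q$, then using one pass over the edge list, for each $j=0,\dots,q-1$ set $\Delta_j\gets\frac{\Delta}{(1+\epsilon/2)^j}$, $p_j\gets\min\{\frac{3K}{\hat\epsilon^2\Delta_j}\ln\frac{2nT}{\delta},1\}$ and build a directed graph $\tilde G_j$ on $U$ by including each of the two directions of each edge of $G[U]$ independently with probability $p_j$; then set $i\gets0$; (2) set $\beta\gets\frac{3\epsilon}{4}$, $H\gets U$, and for each $v\in U$ in arbitrary order compute $\hat d(v)=\frac{1}{p_i}\cdot(\text{out-degree of } v\text{ in }\tilde G_i[H])$ and, if $\hat d(v)\ge\frac{\Delta_i}{1+\beta}$, append $v$ to $\prec$ and set $H\gets H\setminus\{v\}$; then set $U\gets H$; (3) set $i\gets i+1$, and if $i=q$ set $\Delta\gets\frac{\Delta_{q-1}}{1+\epsilon/2}$. Finally return $\prec$. Then, with probability at least $1-\delta$, this algorithm returns a $\frac{1}{1+\epsilon}$-DD order of $G$ using $O\!\left(\frac1c\right)$ passes and $O\!\left(\frac{n^{1+c}}{\epsilon^3}\log\frac{n}{\epsilon\delta}\right)$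 words of memory.
   Context: Streaming model: the edges of $G$ can only be read by sequential scans ("passes") of the edge list, in an arbitrary order; memory is measured in words of $O(\log n)$ bits. For $U\subseteq V$, $G[U]$ is the induced subgraph. For a total order $\prec$ on $V$ and $v\in V$, $G(v)=G[\{u: v\preceq u\}]$, and $d(u\mid G(v))$ is the degree of $u$ in $G(v)$. For $\vartheta>0$, a $\vartheta$-DD order is a total order $\prec$ on $V$ such that for all $v\in V$ with $d(v\mid G(v))\ge1$ and all $u\succeq v$, $d(v\mid G(v))\ge\vartheta\, d(u\mid G(v))$. (The list $\prec$ produced by the algorithm is read as a total order, earlier elements being smaller.)
   Formalization: Once the current degree bound is below 1, the remaining vertices are appended (literally the loop never ends); q≥1 is assumed (else G̃_0 is undefined); bounds use max(1,1/c) for 1/c and min(1,ε) for ε; the vertex order may depend on the pass, i and U, but not on the samples. *)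

theory Defs
  imports "HOL-Probability.Probability"
begin

section \<open>Graphs, edge streams and degree-dominating orders\<close>

definition simple_graph :: "'v set \<Rightarrow> 'v set set \<Rightarrow> bool" where
  "simple_graph V E \<longleftrightarrow> finite V \<and> (\<forall>e\<in>E. e \<subseteq> V \<and> card e = 2)"

text \<open>The orientation in which the list mentions an edge is arbitrary, and so is the order of the
  edges; every edge occurs exactly once.\<close>

definition edge_stream :: "'v set set \<Rightarrow> ('v \<times> 'v) list \<Rightarrow> bool" where
  "edge_stream E es \<longleftrightarrow>
     distinct (map (\<lambda>(u, v). {u, v}) es) \<and> set (map (\<lambda>(u, v). {u, v}) es) = E"

definition induced_edges :: "'v set set \<Rightarrow> 'v set \<Rightarrow> 'v set set" where
  "induced_edges E W = {e \<in> E. e \<subseteq> W}"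

definition vertex_degree :: "'v set set \<Rightarrow> 'v \<Rightarrow> nat" where
  "vertex_degree E u = card {e \<in> E. u \<in> e}"

text \<open>Here \<open>r\<close> is the reflexive form of the order: \<open>(v, u) \<in> r\<close> means that \<open>v\<close> precedes or equals
  \<open>u\<close>. The set \<open>G\<^sub>v\<close> below is the edge set of the graph that the vertices from \<open>v\<close> onwards induce.\<close>

definition dd_order :: "real \<Rightarrow> 'v set \<Rightarrow> 'v set set \<Rightarrow> 'v rel \<Rightarrow> bool" where
  "dd_order \<theta> V E r \<longleftrightarrow>
     linear_order_on V r \<and>
     (\<forall>v\<in>V. let G\<^sub>v = induced_edges E {u \<in> V. (v, u) \<in> r} in
        vertex_degree G\<^sub>v v \<ge> 1 \<longrightarrow>
        (\<forall>u\<in>V. (v, u) \<in> r \<longrightarrow> real (vertex_degree G\<^sub>v v) \<ge> \<theta> * real (vertex_degree G\<^sub>v u)))"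

text \<open>This is a linear order on \<open>V\<close> exactly if the list enumerates \<open>V\<close> without repetition.\<close>

definition list_order :: "'v list \<Rightarrow> 'v rel" where
  "list_order xs = {(xs ! i, xs ! j) |i j. i \<le> j \<and> j < length xs}"


section \<open>Parameters of the algorithm\<close>

definition eps_hat :: "real \<Rightarrow> real" where
  "eps_hat \<epsilon> = \<epsilon> / (4 + 3 * \<epsilon>)"

definition num_rounds :: "nat \<Rightarrow> real \<Rightarrow> real" where
  "num_rounds n \<epsilon> = log (1 + \<epsilon> / 2) (real n)"

text \<open>The number \<open>q\<close> of sampled graphs per pass. The algorithm refers to the graph with index 0,
  so it is meaningful only if this number is at least 1, that is, if \<open>n powr c \<ge> 1 + \<epsilon> / 2\<close>.\<close>

definition num_levels :: "nat \<Rightarrow> real \<Rightarrow> real \<Rightarrow> nat" where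
  "num_levels n \<epsilon> c = nat \<lfloor>log (1 + \<epsilon> / 2) (real n powr c)\<rfloor>"

definition level_bound :: "real \<Rightarrow> real \<Rightarrow> nat \<Rightarrow> real" where
  "level_bound \<epsilon> \<Delta> j = \<Delta> / (1 + \<epsilon> / 2) ^ j"

text \<open>The formula is negative when \<open>2 * n * T < \<delta>\<close>; \<open>bernoulli_pmf\<close> then never samples an arc.\<close>

definition level_prob :: "nat \<Rightarrow> real \<Rightarrow> real \<Rightarrow> real \<Rightarrow> nat \<Rightarrow> real" where
  "level_prob n \<epsilon> \<delta> \<Delta> j =
     (let K = 1 + \<epsilon>; T = num_rounds n \<epsilon> in
      min (3 * K / ((eps_hat \<epsilon>)\<^sup>2 * level_bound \<epsilon> \<Delta> j) * ln (2 * real n * T / \<delta>)) 1)"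


section \<open>The algorithm\<close>

text \<open>
  The fields are the list built so far, the sets \<open>U\<close> and \<open>H\<close>, the number \<open>\<Delta>\<close>, the index \<open>i\<close> and
  the arc sets of the graphs sampled in the last pass. The last two fields record resources:
  the number of passes, and the largest number of words in use at any time.
  The numbers \<open>\<Delta>\<^sub>j\<close> and \<open>p\<^sub>j\<close> are functions of \<open>\<Delta>\<close> and are not separate fields, since \<open>\<Delta>\<close> only
  changes when \<open>i\<close> reaches \<open>q\<close>, after which they are set anew; \<open>words\<close> charges for them.
\<close>

record 'v dd_state =
  order :: "'v list"
  active :: "'v set"
  rest :: "'v set"
  deg_bound :: real
  level :: nat
  sample :: "nat \<Rightarrow> ('v \<times> 'v) set"
  passes :: nat
  peak :: nat

text \<open>
  A vertex or a number takes one word, an arc two. The summand \<open>2 * q\<close> is for the \<open>\<Delta>\<^sub>j\<close> and \<open>p\<^sub>j\<close>.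
  The constant covers \<open>n\<close>, \<open>\<epsilon>\<close>, \<open>\<delta>\<close>, \<open>c\<close>, \<open>eps_hat \<epsilon>\<close>, \<open>\<Delta>\<close>, \<open>K\<close>, \<open>T\<close>, \<open>q\<close>, \<open>i\<close>, \<open>\<beta>\<close>, the edge
  being read, the level \<open>j\<close>, the vertex being processed and its estimated degree.
\<close>

definition words :: "nat \<Rightarrow> 'v dd_state \<Rightarrow> nat" where
  "words q s = length (order s) + card (active s) + card (rest s)
     + (\<Sum>j<q. 2 * card (sample s j)) + 2 * q + 16"

definition charge :: "nat \<Rightarrow> 'v dd_state \<Rightarrow> 'v dd_state" where
  "charge q s = s\<lparr>peak := max (peak s) (words q s)\<rparr>"

primrec fold_pmf :: "('a \<Rightarrow> 's \<Rightarrow> 's pmf) \<Rightarrow> 'a list \<Rightarrow> 's \<Rightarrow> 's pmf" where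
  "fold_pmf f [] s = return_pmf s"
| "fold_pmf f (x # xs) s = bind_pmf (f x s) (fold_pmf f xs)"

definition sample_arc ::
    "nat \<Rightarrow> (nat \<Rightarrow> real) \<Rightarrow> nat \<times> 'v \<times> 'v \<Rightarrow> 'v dd_state \<Rightarrow> 'v dd_state pmf" where
  "sample_arc q p = (\<lambda>(j, a) s.
     map_pmf (\<lambda>b. charge q (if b then s\<lparr>sample := (sample s)(j := insert a (sample s j))\<rparr> else s))
       (bernoulli_pmf (p j)))"

definition read_edge ::
    "nat \<Rightarrow> (nat \<Rightarrow> real) \<Rightarrow> 'v \<times> 'v \<Rightarrow> 'v dd_state \<Rightarrow> 'v dd_state pmf" where
  "read_edge q p = (\<lambda>(u, v) s.
     if u \<in> active s \<and> v \<in> active s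
     then fold_pmf (sample_arc q p) (List.product [0..<q] [(u, v), (v, u)]) s
     else return_pmf s)"

text \<open>One pass. This is the only place where the algorithm accesses the edges.\<close>

definition scan ::
    "('v \<times> 'v) list \<Rightarrow> nat \<Rightarrow> real \<Rightarrow> real \<Rightarrow> nat \<Rightarrow> 'v dd_state \<Rightarrow> 'v dd_state pmf" where
  "scan es n \<epsilon> \<delta> q s =
     fold_pmf (read_edge q (level_prob n \<epsilon> \<delta> (deg_bound s))) es
       (s\<lparr>sample := (\<lambda>_. {}), level := 0, passes := Suc (passes s)\<rparr>)"

definition process_vertex ::
    "nat \<Rightarrow> real \<Rightarrow> real \<Rightarrow> nat \<Rightarrow> 'v \<Rightarrow> 'v dd_state \<Rightarrow> 'v dd_state" where
  "process_vertex n \<epsilon> \<delta> q v s =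
     (let \<beta> = 3 * \<epsilon> / 4;
          i = level s;
          d = 1 / level_prob n \<epsilon> \<delta> (deg_bound s) i
                * real (card {w \<in> rest s. (v, w) \<in> sample s i})
      in charge q (if d \<ge> level_bound \<epsilon> (deg_bound s) i / (1 + \<beta>)
           then s\<lparr>order := order s @ [v], rest := rest s - {v}\<rparr> else s))"

definition peel ::
    "(nat \<Rightarrow> nat \<Rightarrow> 'v set \<Rightarrow> 'v list) \<Rightarrow> nat \<Rightarrow> real \<Rightarrow> real \<Rightarrow> nat \<Rightarrow> 'v dd_state \<Rightarrow> 'v dd_state" where
  "peel enum n \<epsilon> \<delta> q s =
     (let s' = fold (process_vertex n \<epsilon> \<delta> q) (enum (passes s) (level s) (active s))
                 (charge q (s\<lparr>rest := active s\<rparr>))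
      in s'\<lparr>active := rest s'\<rparr>)"

definition next_level :: "real \<Rightarrow> nat \<Rightarrow> 'v dd_state \<Rightarrow> 'v dd_state" where
  "next_level \<epsilon> q s =
     (if Suc (level s) = q
      then s\<lparr>level := q, deg_bound := level_bound \<epsilon> (deg_bound s) (q - 1) / (1 + \<epsilon> / 2)\<rparr>
      else s\<lparr>level := Suc (level s)\<rparr>)"

definition dd_round ::
    "('v \<times> 'v) list \<Rightarrow> (nat \<Rightarrow> nat \<Rightarrow> 'v set \<Rightarrow> 'v list) \<Rightarrow> nat \<Rightarrow> real \<Rightarrow> real \<Rightarrow> nat
      \<Rightarrow> 'v dd_state \<Rightarrow> 'v dd_state pmf" where
  "dd_round es enum n \<epsilon> \<delta> q s =
     map_pmf (\<lambda>s. next_level \<epsilon> q (peel enum n \<epsilon> \<delta> q s))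
       (if level s = q then scan es n \<epsilon> \<delta> q s else return_pmf s)"

text \<open>
  The bound on the degrees in the graph induced by \<open>U\<close> that the coming round works with. Once it
  is below 1 it allows no edges, but the sampling rounds would never remove the remaining vertices:
  an isolated vertex has estimated degree 0, and the threshold is always positive. So they are
  appended in arbitrary order, which is what makes the loop terminate.
\<close>

definition current_bound :: "real \<Rightarrow> nat \<Rightarrow> 'v dd_state \<Rightarrow> real" where
  "current_bound \<epsilon> q s =
     (if level s = q then deg_bound s else level_bound \<epsilon> (deg_bound s) (level s))"

definition append_rest ::
    "(nat \<Rightarrow> nat \<Rightarrow> 'v set \<Rightarrow> 'v list) \<Rightarrow> nat \<Rightarrow> 'v dd_state \<Rightarrow> 'v dd_state" where
  "append_rest enum q s =
     charge q (s\<lparr>order := order s @ enum (passes s) (level s) (active s), active := {}, rest := {}\<rparr>)"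

partial_function (spmf) dd_loop ::
    "('v \<times> 'v) list \<Rightarrow> (nat \<Rightarrow> nat \<Rightarrow> 'v set \<Rightarrow> 'v list) \<Rightarrow> nat \<Rightarrow> real \<Rightarrow> real \<Rightarrow> nat
      \<Rightarrow> 'v dd_state \<Rightarrow> 'v dd_state spmf" where
  "dd_loop es enum n \<epsilon> \<delta> q s =
     (if active s = {} then return_spmf s
      else if current_bound \<epsilon> q s < 1 then dd_loop es enum n \<epsilon> \<delta> q (append_rest enum q s)
      else bind_spmf (spmf_of_pmf (dd_round es enum n \<epsilon> \<delta> q s))
             (dd_loop es enum n \<epsilon> \<delta> q))"

definition dd_init :: "'v set \<Rightarrow> nat \<Rightarrow> 'v dd_state" where
  "dd_init V q = charge q
     \<lparr>order = [], active = V, rest = {}, deg_bound = real (card V) - 1, level = q,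
      sample = (\<lambda>_. {}), passes = 0, peak = 0\<rparr>"

text \<open>
  The result is the final state: its field \<open>order\<close> is the returned list. Diverging runs are the
  missing mass of the subprobability distribution.
\<close>

definition dd_algorithm ::
    "'v set \<Rightarrow> ('v \<times> 'v) list \<Rightarrow> (nat \<Rightarrow> nat \<Rightarrow> 'v set \<Rightarrow> 'v list) \<Rightarrow> real \<Rightarrow> real \<Rightarrow> real
      \<Rightarrow> 'v dd_state spmf" where
  "dd_algorithm V es enum \<epsilon> \<delta> c =
     (let n = card V; q = num_levels n \<epsilon> c in dd_loop es enum n \<epsilon> \<delta> q (dd_init V q))"

text \<open>
  The arbitrary orders in which the vertices of \<open>U\<close> are processed: they may depend on \<open>U\<close>, on the
  number of passes made and on the index \<open>i\<close>, but not on the sampled graphs.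
\<close>

definition vertex_enumeration :: "'v set \<Rightarrow> (nat \<Rightarrow> nat \<Rightarrow> 'v set \<Rightarrow> 'v list) \<Rightarrow> bool" where
  "vertex_enumeration V enum \<longleftrightarrow>
     (\<forall>k i U. U \<subseteq> V \<longrightarrow> set (enum k i U) = U \<and> distinct (enum k i U))"

end

theory Submission
  imports Defs
begin

text \<open>
  Write \<open>\<alpha> = 1 + \<epsilon> / 2\<close>. Round \<open>t\<close> works with the degree bound \<open>(n - 1) / \<alpha> ^ t\<close>. If every
  estimate made in it is accurate up to the factor \<open>1 \<plusminus> eps_hat \<epsilon>\<close>, then a vertex that is appended
  has degree at least \<open>1 / (1 + \<epsilon>)\<close> times the bound, and a vertex that is kept has degree at most the
  bound of round \<open>t + 1\<close>; so the list is a degree-dominating order. The arcs leaving \<open>v\<close> are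
  independent of the set that \<open>v\<close> meets, hence by Chernoff a single estimate fails with probability
  at most \<open>\<delta> / (2 n T)\<close>, and never if the sampling probability is 1. Sampling probabilities below 1
  occur in at most \<open>T\<close> rounds if \<open>T \<ge> 1\<close>, which gives a total of \<open>\<delta> / 2\<close>. If \<open>T < 1\<close>, then
  \<open>n < 1 + \<epsilon>\<close> and every order is degree-dominating. The remaining \<open>\<delta> / 2\<close> pays for the event that
  one of the at most \<open>\<lceil>T / q\<rceil>\<close> passes samples more arcs than the memory bound allows.
\<close>

section \<open>Products of Bernoulli distributions and Chernoff bounds\<close>

text \<open>The obstacle is adaptivity: all graphs of a pass are drawn before the first vertex is
  judged, while the set that graph i is applied to is shaped by the graphs before it. The peeling is
  therefore restated as a function of the samples alone (\<open>strip\<close>,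
  \<open>active_at\<close>), so that a misjudgement becomes an event in a product space, open to
  independence and union bounds. Only good runs are followed. Nothing is shown about runs that leave
  the good event, and termination needs no argument of its own: \<open>deg_bound\<close> falls below
  1 after \<open>max_passes\<close> passes, and then the loop exits. If T < 1, the logarithm in the
  sampling probability can be small or even negative and no estimate can be trusted. Hence claims
  about accuracy carry the guard \<open>1 \<le> T\<close>, whereas the bounds on passes and memory
  are proved in both cases.\<close>

lemma bernoulli_pmf_clip: "bernoulli_pmf p = bernoulli_pmf (min 1 (max 0 p))"
  by (rule pmf_eqI) (simp add: bernoulli_pmf.rep_eq)

text \<open>Fubini for a product: the coordinates outside \<open>B\<close> are drawn as
  \<open>g\<close>, and a bound valid for each \<open>g\<close> survives averaging. Functions that
  take the default value outside \<open>A - B\<close> carry all the mass.\<close>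

lemma prob_Pi_pmf_condition:
  assumes "finite A" "B \<subseteq> A"
    and le: "\<And>g. (\<forall>x. x \<notin> A - B \<longrightarrow> g x = d) \<Longrightarrow> measure_pmf.prob (Pi_pmf B d p) {f. P (\<lambda>x. if x \<in> B then f x else g x)} \<le> b"
  shows "measure_pmf.prob (Pi_pmf A d p) {f. P f} \<le> b"
proof -
  have fin: "finite B" "finite (A - B)" using assms finite_subset by auto
  have "A = B \<union> (A - B)" using assms by auto
  then have "Pi_pmf A d p = Pi_pmf (B \<union> (A - B)) d p" by simp
  also have "\<dots> = map_pmf (\<lambda>(f, g) x. if x \<in> B then f x else g x)
      (pair_pmf (Pi_pmf B d p) (Pi_pmf (A - B) d p))"
    by (rule Pi_pmf_union) (use fin in auto)
  also have "\<dots> = bind_pmf (Pi_pmf (A - B) d p)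
      (\<lambda>g. map_pmf (\<lambda>f x. if x \<in> B then f x else g x) (Pi_pmf B d p))"
    unfolding pair_pmf_def map_bind_pmf map_pmf_def bind_assoc_pmf bind_return_pmf split_conv
    by (rule bind_commute_pmf)
  finally have eq: "Pi_pmf A d p = \<dots>" .
  have b: "0 \<le> b" by (rule order_trans[OF measure_nonneg le[of "\<lambda>_. d"]]) simp
  have "emeasure (Pi_pmf A d p) {f. P f} =
      (\<integral>\<^sup>+g. emeasure (Pi_pmf B d p) {f. P (\<lambda>x. if x \<in> B then f x else g x)} \<partial>Pi_pmf (A - B) d p)"
    unfolding eq by (simp add: vimage_def)
  also have "\<dots> \<le> (\<integral>\<^sup>+g. ennreal b \<partial>Pi_pmf (A - B) d p)"
  proof (intro nn_integral_mono_AE AE_pmfI)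
    fix g assume "g \<in> set_pmf (Pi_pmf (A - B) d p)"
    from subsetD[OF set_Pi_pmf_subset[OF fin(2)] this]
    have "\<forall>x. x \<notin> A - B \<longrightarrow> g x = d" by simp
    then show "emeasure (Pi_pmf B d p) {f. P (\<lambda>x. if x \<in> B then f x else g x)} \<le> ennreal b"
      using le[of g] by (simp add: measure_pmf.emeasure_eq_measure ennreal_leI)
  qed
  also have "\<dots> = ennreal b" by simp
  finally show ?thesis by (simp add: measure_pmf.emeasure_eq_measure b)
qed

text \<open>Outside a bad set of mass at most b the continuation succeeds with probability at least
  1 - r, and (1 - b)(1 - r) \<ge> 1 - (b + r). Bad outcomes are defined by the continuation itself,
  so they may do anything, including diverge.\<close>

lemma prob_bind_spmf_ge:
  fixes f :: "'a \<Rightarrow> 'b spmf"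
  assumes bad: "measure_pmf.prob p {x. \<not> 1 - r \<le> measure (measure_spmf (f x)) X} \<le> b"
    and r: "0 \<le> r"
  shows "1 - (b + r) \<le> measure (measure_spmf (bind_spmf (spmf_of_pmf p) f)) X"
proof (cases "r \<le> 1")
  case False
  have "0 \<le> b" using bad by (meson measure_nonneg order_trans)
  then have "1 - (b + r) \<le> 0" using False by simp
  then show ?thesis by (meson measure_nonneg order_trans)
next
  case True
  let ?G = "{x. 1 - r \<le> measure (measure_spmf (f x)) X}"
  have "measure_pmf.prob p {x. \<not> 1 - r \<le> measure (measure_spmf (f x)) X} = 1 - measure_pmf.prob p ?G"
    using measure_pmf.prob_compl[of ?G p] by (simp add: Compl_eq[symmetric] Compl_eq_Diff_UNIV[symmetric] Collect_neg_eq)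
  with bad have G: "1 - b \<le> measure_pmf.prob p ?G" by simp
  have "0 \<le> b" using bad by (meson measure_nonneg order_trans)
  then have "1 - (b + r) \<le> (1 - r) * (1 - b)" using r by (simp add: algebra_simps)
  also have "\<dots> \<le> (1 - r) * measure_pmf.prob p ?G" using G True by (intro mult_left_mono) auto
  finally have *: "1 - (b + r) \<le> (1 - r) * measure_pmf.prob p ?G" .
  have "ennreal ((1 - r) * measure_pmf.prob p ?G) = (\<integral>\<^sup>+x. ennreal (1 - r) * indicator ?G x \<partial>p)"
    using True by (simp add: nn_integral_cmult ennreal_mult measure_pmf.emeasure_eq_measure)
  also have "\<dots> \<le> (\<integral>\<^sup>+x. emeasure (f x) (Some ` X) \<partial>p)"
    by (intro nn_integral_mono)
      (auto simp: measure_pmf.emeasure_eq_measure measure_measure_spmf_conv_measure_pmf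
         space_measure_spmf intro!: ennreal_leI split: split_indicator)
  also have "\<dots> = emeasure (bind_pmf p f) (Some ` X)" by simp
  also have "\<dots> = ennreal (measure (measure_spmf (bind_spmf (spmf_of_pmf p) f)) X)"
    by (simp add: measure_pmf.emeasure_eq_measure measure_measure_spmf_conv_measure_pmf)
  finally have "(1 - r) * measure_pmf.prob p ?G \<le> measure (measure_spmf (bind_spmf (spmf_of_pmf p) f)) X"
    by (simp add: ennreal_le_iff)
  with * show ?thesis by linarith
qed

text \<open>Markov's inequality for exp (t N), N being the number of successes, and 1 + y \<le> exp
  y in each factor. A factor t of either sign covers both tails at once. The probabilities may
  differ, since the levels of a pass are sampled at different rates.\<close>

lemma bernoulli_chernoff_mgf:
  fixes p :: "'a \<Rightarrow> real"
  assumes "finite B" "D \<subseteq> B" and p: "\<And>x. x \<in> D \<Longrightarrow> 0 \<le> p x \<and> p x \<le> 1"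
  shows "measure_pmf.prob (Pi_pmf B False (\<lambda>x. bernoulli_pmf (p x)))
      {f. t * a \<le> t * real (card {x \<in> D. f x})} \<le> exp (- t * a + (exp t - 1) * (\<Sum>x\<in>D. p x))"
proof -
  have D: "finite D" using assms finite_subset by auto
  let ?P = "Pi_pmf D False (\<lambda>x. bernoulli_pmf (p x))"
  let ?h = "\<lambda>f x. x \<in> D \<and> f x"
  have P: "?P = map_pmf (\<lambda>f x. if x \<in> D then f x else False) (Pi_pmf B False (\<lambda>x. bernoulli_pmf (p x)))"
    by (rule Pi_pmf_subset) (use assms in auto)
  have "measure_pmf.prob (Pi_pmf B False (\<lambda>x. bernoulli_pmf (p x)))
      {f. t * a \<le> t * real (card {x \<in> D. f x})} = measure_pmf.prob ?P {f. t * a \<le> t * real (card {x \<in> D. f x})}"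
    unfolding P by (simp add: vimage_def cong: conj_cong)
  also have "\<dots> = measure_pmf.prob ?P {f\<in>space ?P. exp (t * a) \<le> (\<Prod>x\<in>D. if f x then exp t else 1)}"
  proof -
    have "(\<Prod>x\<in>D. if f x then exp t else 1) = exp (t * real (card {x \<in> D. f x}))" for f
      using D by (simp add: prod.If_cases Int_def exp_of_nat_mult[symmetric] mult.commute)
    then show ?thesis by simp
  qed
  also have "\<dots> \<le> measure_pmf.expectation ?P (\<lambda>f. \<Prod>x\<in>D. if f x then exp t else 1) / exp (t * a)"
  proof (rule integral_Markov_inequality_measure)
    show "integrable ?P (\<lambda>f. \<Prod>x\<in>D. if f x then exp t else 1)"
      by (rule integrable_measure_pmf_finite) (use D in \<open>auto simp: set_Pi_pmf\<close>)
  qed (auto intro!: prod_nonneg)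
  also have "measure_pmf.expectation ?P (\<lambda>f. \<Prod>x\<in>D. if f x then exp t else 1) =
      (\<Prod>x\<in>D. measure_pmf.expectation (bernoulli_pmf (p x)) (\<lambda>b. if b then exp t else 1))"
    by (rule expectation_prod_Pi_pmf[OF D]) (auto intro!: integrable_measure_pmf_finite)
  also have "\<dots> = (\<Prod>x\<in>D. 1 + p x * (exp t - 1))"
    using p by (intro prod.cong) (auto simp: algebra_simps)
  also have "\<dots> \<le> (\<Prod>x\<in>D. exp (p x * (exp t - 1)))"
  proof (intro prod_mono conjI)
    fix x assume x: "x \<in> D"
    have "0 \<le> 1 - p x + p x * exp t" using p[OF x] by (intro add_nonneg_nonneg mult_nonneg_nonneg) auto
    then show "0 \<le> 1 + p x * (exp t - 1)" by (simp add: algebra_simps)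
  qed (rule exp_ge_add_one_self)
  also have "\<dots> = exp ((exp t - 1) * (\<Sum>x\<in>D. p x))"
    by (simp add: exp_sum[OF D] sum_distrib_left mult.commute[of _ "exp t - 1"])
  finally have "measure_pmf.prob (Pi_pmf B False (\<lambda>x. bernoulli_pmf (p x)))
      {f. t * a \<le> t * real (card {x \<in> D. f x})} \<le> exp ((exp t - 1) * (\<Sum>x\<in>D. p x)) / exp (t * a)"
    by (simp add: divide_right_mono)
  then show ?thesis by (simp add: exp_diff[symmetric])
qed

text \<open>The difference of the two sides vanishes at 0 and has derivative ln (1 + y) - 2 y / 3.
  By ln (1 + y) \<ge> y - y^2 this is nonnegative up to y = 1/3, a range that contains
  \<open>eps_hat\<close>.\<close>

lemma chernoff_upper_exponent:
  assumes "0 \<le> x" "x \<le> (1/3 :: real)"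
  shows "x\<^sup>2 / 3 \<le> (1 + x) * ln (1 + x) - x"
proof -
  let ?f = "\<lambda>x :: real. (1 + x) * ln (1 + x) - x - x\<^sup>2 / 3"
  have "?f 0 \<le> ?f x"
  proof (rule DERIV_nonneg_imp_nondecreasing[OF assms(1)])
    fix y assume y: "0 \<le> y" "y \<le> x"
    have "(?f has_real_derivative ln (1 + y) - 2 * y / 3) (at y)"
      using y by (auto intro!: derivative_eq_intros)
    moreover have "y * y \<le> y * (1 / 3)" using y assms by (intro mult_left_mono) auto
    then have "0 \<le> ln (1 + y) - 2 * y / 3"
      using ln_one_plus_pos_lower_bound[of y] y assms by (simp add: power2_eq_square)
    ultimately show "\<exists>d. (?f has_real_derivative d) (at y) \<and> 0 \<le> d" by blast
  qed
  then show ?thesis by simp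
qed

lemma chernoff_lower_exponent:
  assumes "0 \<le> x" "x < (1 :: real)"
  shows "x\<^sup>2 / 3 \<le> (1 - x) * ln (1 - x) + x"
proof -
  let ?f = "\<lambda>x :: real. (1 - x) * ln (1 - x) + x - x\<^sup>2 / 3"
  have "?f 0 \<le> ?f x"
  proof (rule DERIV_nonneg_imp_nondecreasing[OF assms(1)])
    fix y assume y: "0 \<le> y" "y \<le> x"
    have "(?f has_real_derivative - ln (1 - y) - 2 * y / 3) (at y)"
      using y assms by (auto intro!: derivative_eq_intros)
    moreover have "0 \<le> - ln (1 - y) - 2 * y / 3"
      using ln_le_minus_one[of "1 - y"] y assms by simp
    ultimately show "\<exists>d. (?f has_real_derivative d) (at y) \<and> 0 \<le> d" by blast
  qed
  then show ?thesis by simp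
qed

text \<open>t = ln (1 + x) is the optimal parameter. As it is positive, the moment bound increases
  with the mean, so \<mu> need only lie above the mean; this lets a threshold degree stand for all
  smaller degrees.\<close>

lemma chernoff_upper:
  assumes "finite B" "D \<subseteq> B" "0 \<le> p" "p \<le> 1" "0 \<le> x" "x \<le> 1/3" "real (card D) * p \<le> \<mu>"
  shows "measure_pmf.prob (Pi_pmf B False (\<lambda>_. bernoulli_pmf p))
      {f. (1 + x) * \<mu> \<le> real (card {y \<in> D. f y})} \<le> exp (- x\<^sup>2 * \<mu> / 3)"
proof (cases "x = 0")
  case False
  then have t: "ln (1 + x) > 0" using assms by simp
  have mu: "0 \<le> \<mu>" using assms by (meson mult_nonneg_nonneg of_nat_0_le_iff order_trans)
  have "x * (card D * p) \<le> x * \<mu>" using assms by (intro mult_left_mono) auto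
  moreover have "x\<^sup>2 / 3 * \<mu> \<le> ((1 + x) * ln (1 + x) - x) * \<mu>"
    using mu chernoff_upper_exponent[of x] assms by (intro mult_right_mono) auto
  ultimately have "- ln (1 + x) * ((1 + x) * \<mu>) + (exp (ln (1 + x)) - 1) * (\<Sum>x\<in>D. p) \<le> - x\<^sup>2 * \<mu> / 3"
    using assms by (simp add: algebra_simps)
  moreover have "{f. (1 + x) * \<mu> \<le> real (card {y \<in> D. f y})} =
      {f. ln (1 + x) * ((1 + x) * \<mu>) \<le> ln (1 + x) * real (card {y \<in> D. f y})}"
    using t by simp
  ultimately show ?thesis
    using bernoulli_chernoff_mgf[of B D "\<lambda>_. p" "ln (1 + x)" "(1 + x) * \<mu>"] assms
    by (metis (no_types, lifting) exp_le_cancel_iff order_trans)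
qed simp

lemma chernoff_lower:
  assumes "finite B" "D \<subseteq> B" "0 \<le> p" "p \<le> 1" "0 \<le> x" "x < 1" "0 \<le> \<mu>" "\<mu> \<le> real (card D) * p"
  shows "measure_pmf.prob (Pi_pmf B False (\<lambda>_. bernoulli_pmf p))
      {f. real (card {y \<in> D. f y}) \<le> (1 - x) * \<mu>} \<le> exp (- x\<^sup>2 * \<mu> / 3)"
proof (cases "x = 0")
  case False
  then have t: "ln (1 - x) < 0" using assms by simp
  have "x * \<mu> \<le> x * (card D * p)" using assms by (intro mult_left_mono) auto
  moreover have "x\<^sup>2 / 3 * \<mu> \<le> ((1 - x) * ln (1 - x) + x) * \<mu>"
    using chernoff_lower_exponent[of x] assms by (intro mult_right_mono) auto
  ultimately have "- ln (1 - x) * ((1 - x) * \<mu>) + (exp (ln (1 - x)) - 1) * (\<Sum>x\<in>D. p) \<le> - x\<^sup>2 * \<mu> / 3"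
    using assms by (simp add: algebra_simps)
  moreover have "{f. real (card {y \<in> D. f y}) \<le> (1 - x) * \<mu>} =
      {f. ln (1 - x) * ((1 - x) * \<mu>) \<le> ln (1 - x) * real (card {y \<in> D. f y})}"
    using t by simp
  ultimately show ?thesis
    using bernoulli_chernoff_mgf[of B D "\<lambda>_. p" "ln (1 - x)" "(1 - x) * \<mu>"] assms
    by (metis (no_types, lifting) exp_le_cancel_iff order_trans)
qed simp

section \<open>The distribution of the sampled arcs\<close>

lemma fold_pmf_append: "fold_pmf f (xs @ ys) s = bind_pmf (fold_pmf f xs s) (fold_pmf f ys)"
  by (induction xs arbitrary: s) (auto simp: bind_return_pmf bind_assoc_pmf intro!: bind_pmf_cong)

text \<open>What any stretch of coin tosses does to a state. Stored arcs only accumulate, so the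
  words in use at the end bound those at every earlier moment, and the peak of a pass can be read
  off its last state.\<close>

definition sampling_ext :: "nat \<Rightarrow> 'v dd_state \<Rightarrow> 'v dd_state \<Rightarrow> bool" where
  "sampling_ext q s s' \<longleftrightarrow> (\<exists>S m. s' = s\<lparr>sample := S, peak := m\<rparr>) \<and>
     peak s' \<le> max (peak s) (words q s') \<and> words q s \<le> words q s'"

lemma sampling_ext_refl: "sampling_ext q s s"
proof -
  have "s = s\<lparr>sample := sample s, peak := peak s\<rparr>" by simp
  then show ?thesis unfolding sampling_ext_def by (metis max.cobounded1 order_refl)
qed

lemma sampling_ext_trans:
  assumes "sampling_ext q s s'" "sampling_ext q s' s''"
  shows "sampling_ext q s s''"
proof -
  obtain S m S' m' where "s' = s\<lparr>sample := S, peak := m\<rparr>" "s'' = s'\<lparr>sample := S', peak := m'\<rparr>"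
    using assms unfolding sampling_ext_def by blast
  then have "s'' = s\<lparr>sample := S', peak := m'\<rparr>" by simp
  moreover have "peak s'' \<le> max (peak s) (words q s'')" "words q s \<le> words q s''"
    using assms unfolding sampling_ext_def by linarith+
  ultimately show ?thesis unfolding sampling_ext_def by blast
qed

lemma sampling_ext_sample_arc:
  assumes "s' \<in> set_pmf (sample_arc q p x s)"
  shows "sampling_ext q s s'"
proof -
  obtain j a where x: "x = (j, a)" by (cases x)
  have "(\<Sum>i<q. card (sample s i)) \<le> (\<Sum>i<q. card (((sample s)(j := insert a (sample s j))) i))"
    by (intro sum_mono) (auto intro: card_insert_le)
  then have "words q s \<le> words q (s\<lparr>sample := (sample s)(j := insert a (sample s j))\<rparr>)"
    by (simp add: words_def sum_distrib_left[symmetric])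
  then have grow: "words q s \<le> words q (s\<lparr>sample := S\<rparr>)"
    if "S = sample s \<or> S = (sample s)(j := insert a (sample s j))" for S
    using that by auto
  have ext: "sampling_ext q s (charge q (s\<lparr>sample := S\<rparr>))"
    if "S = sample s \<or> S = (sample s)(j := insert a (sample s j))" for S
  proof -
    have eq: "charge q (s\<lparr>sample := S\<rparr>) = s\<lparr>sample := S, peak := max (peak s) (words q (s\<lparr>sample := S\<rparr>))\<rparr>"
      by (simp add: charge_def)
    have "words q (s\<lparr>sample := S, peak := m\<rparr>) = words q (s\<lparr>sample := S\<rparr>)" for m
      by (simp add: words_def)
    then show ?thesis unfolding sampling_ext_def eq using grow[OF that] by auto
  qed
  have "s' = charge q s \<or> s' = charge q (s\<lparr>sample := (sample s)(j := insert a (sample s j))\<rparr>)"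
    using assms x by (auto simp: sample_arc_def)
  then show ?thesis using ext[of "sample s"] ext[of "(sample s)(j := insert a (sample s j))"] by auto
qed

lemma sampling_ext_fold:
  "s' \<in> set_pmf (fold_pmf (sample_arc q p) xs s) \<Longrightarrow> sampling_ext q s s'"
proof (induction xs arbitrary: s)
  case (Cons x xs)
  then obtain t where "t \<in> set_pmf (sample_arc q p x s)" "s' \<in> set_pmf (fold_pmf (sample_arc q p) xs t)"
    by auto
  then show ?case using Cons.IH sampling_ext_sample_arc sampling_ext_trans by blast
qed (simp add: sampling_ext_refl)

lemma sampling_ext_active: "sampling_ext q s s' \<Longrightarrow> active s' = active s"
  by (auto simp: sampling_ext_def)

text \<open>Successive tosses form a product distribution as soon as no entry repeats: each toss
  sets a coordinate of its own, and its probability does not depend on the state.\<close>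

lemma map_sample_fold:
  assumes "distinct xs"
  shows "map_pmf sample (fold_pmf (sample_arc q p) xs s) =
    map_pmf (\<lambda>f j. sample s j \<union> {a. f (j, a)}) (Pi_pmf (set xs) False (\<lambda>x. bernoulli_pmf (p (fst x))))"
  using assms
proof (induction xs arbitrary: s)
  case (Cons x xs)
  obtain j a where x: "x = (j, a)" by (cases x)
  let ?P = "Pi_pmf (set xs) False (\<lambda>x. bernoulli_pmf (p (fst x)))"
  let ?t = "\<lambda>b. charge q (if b then s\<lparr>sample := (sample s)(j := insert a (sample s j))\<rparr> else s)"
  have "map_pmf sample (fold_pmf (sample_arc q p) (x # xs) s) =
      bind_pmf (bernoulli_pmf (p j)) (\<lambda>b. map_pmf sample (fold_pmf (sample_arc q p) xs (?t b)))"
    by (simp add: x sample_arc_def map_bind_pmf bind_map_pmf)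
  also have "\<dots> = bind_pmf (bernoulli_pmf (p j))
      (\<lambda>b. map_pmf (\<lambda>f j. sample (?t b) j \<union> {a. f (j, a)}) ?P)"
    using Cons by (intro bind_pmf_cong refl) simp
  also have "\<dots> = bind_pmf (bernoulli_pmf (p j))
      (\<lambda>b. map_pmf (\<lambda>f j'. sample s j' \<union> {a'. (f((j, a) := b)) (j', a')}) ?P)"
  proof (intro bind_pmf_cong map_pmf_cong refl)
    fix b f assume "f \<in> set_pmf ?P"
    \<comment> \<open>The head is not a coordinate of \<open>f\<close>, which therefore has its
      default value False there; inserting the arc amounts to updating \<open>f\<close> at the
      head.\<close>
    then have "\<not> f (j, a)" using Cons.prems x by (cases a) (auto simp: set_Pi_pmf PiE_dflt_def)
    then show "(\<lambda>j. sample (?t b) j \<union> {a. f (j, a)}) = (\<lambda>j'. sample s j' \<union> {a'. (f((j, a) := b)) (j', a')})"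
      by (auto simp: fun_eq_iff charge_def)
  qed
  also have "\<dots> = map_pmf (\<lambda>f j. sample s j \<union> {a. f (j, a)})
      (Pi_pmf (set (x # xs)) False (\<lambda>x. bernoulli_pmf (p (fst x))))"
    using Cons.prems unfolding x
    by (simp add: Pi_pmf_insert' map_pmf_def bind_assoc_pmf bind_return_pmf)
  finally show ?case .
qed simp

definition arc_list :: "nat \<Rightarrow> 'v set \<Rightarrow> ('v \<times> 'v) list \<Rightarrow> (nat \<times> 'v \<times> 'v) list" where
  "arc_list q U es = concat (map (\<lambda>(u, v).
     if u \<in> U \<and> v \<in> U then List.product [0..<q] [(u, v), (v, u)] else []) es)"

definition arcs :: "'v set set \<Rightarrow> 'v set \<Rightarrow> ('v \<times> 'v) set" where
  "arcs E U = {(u, v). u \<in> U \<and> v \<in> U \<and> {u, v} \<in> E}"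

text \<open>A pass never changes \<open>active\<close>, so which edges are sampled is settled at its
  start and the nested folds flatten to one sequence of tosses.\<close>

lemma fold_read_edge:
  "fold_pmf (read_edge q p) es s = fold_pmf (sample_arc q p) (arc_list q (active s) es) s"
proof (induction es arbitrary: s)
  case (Cons e es)
  obtain u v where e: "e = (u, v)" by force
  show ?case
  proof (cases "u \<in> active s \<and> v \<in> active s")
    case True
    have "fold_pmf (read_edge q p) (e # es) s =
      bind_pmf (fold_pmf (sample_arc q p) (List.product [0..<q] [(u, v), (v, u)]) s)
        (fold_pmf (read_edge q p) es)"
      using True by (simp add: e read_edge_def)
    also have "\<dots> = bind_pmf (fold_pmf (sample_arc q p) (List.product [0..<q] [(u, v), (v, u)]) s)
        (fold_pmf (sample_arc q p) (arc_list q (active s) es))"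
      by (intro bind_pmf_cong refl) (simp add: Cons.IH sampling_ext_active[OF sampling_ext_fold])
    also have "\<dots> = fold_pmf (sample_arc q p) (arc_list q (active s) (e # es)) s"
      using True by (simp add: arc_list_def e fold_pmf_append[symmetric])
    finally show ?thesis .
  next
    case False
    then show ?thesis
      using Cons.IH by (auto simp: e read_edge_def arc_list_def bind_return_pmf)
  qed
qed (simp add: arc_list_def)

lemma set_arc_list:
  assumes "edge_stream E es"
  shows "set (arc_list q U es) = {0..<q} \<times> arcs E U"
proof -
  have E: "{a, b} \<in> E \<longleftrightarrow> (a, b) \<in> set es \<or> (b, a) \<in> set es" for a b
    using assms unfolding edge_stream_def by (auto simp: doubleton_eq_iff)
  have "(j, a, b) \<in> set (arc_list q U es) \<longleftrightarrow> (j, a, b) \<in> {0..<q} \<times> arcs E U" for j a b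
    unfolding arc_list_def arcs_def using E[of a b]
    by (simp split: if_splits prod.splits) blast
  then show ?thesis by auto
qed

text \<open>A loop would yield the same arc for both directions, and an edge listed in both
  orientations would yield each of its arcs twice. Edges with two elements exclude the former, a
  stream without repeated edge sets the latter.\<close>

lemma distinct_arc_list:
  assumes "simple_graph V E" "edge_stream E es"
  shows "distinct (arc_list q U es)"
proof -
  have "\<forall>(u, v)\<in>set es. u \<noteq> v"
    using assms by (force simp: simple_graph_def edge_stream_def)
  moreover have "distinct (map (\<lambda>(u, v). {u, v}) es)" using assms by (simp add: edge_stream_def)
  ultimately show ?thesis
  proof (induction es)
    case (Cons e es)
    obtain u v where e: "e = (u, v)" by force
    have "(u, v) \<notin> set es" "(v, u) \<notin> set es" using Cons.prems e by (force simp: insert_commute)+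
    then have "set (List.product [0..<q] [(u, v), (v, u)]) \<inter> set (arc_list q U es) = {}"
      by (auto simp: arc_list_def split: if_splits)
    then show ?case using Cons e by (auto simp: arc_list_def distinct_product)
  qed (simp add: arc_list_def)
qed

lemma prob_scan:
  assumes "simple_graph V E" "edge_stream E es"
  shows "measure_pmf.prob (scan es n \<epsilon> \<delta> q s) {s'. Q (sample s')} =
    measure_pmf.prob (Pi_pmf ({0..<q} \<times> arcs E (active s)) False
       (\<lambda>x. bernoulli_pmf (level_prob n \<epsilon> \<delta> (deg_bound s) (fst x)))) {f. Q (\<lambda>j. {a. f (j, a)})}"
proof -
  let ?s = "s\<lparr>sample := (\<lambda>_. {}), level := 0, passes := Suc (passes s)\<rparr>"
  have "measure_pmf.prob (scan es n \<epsilon> \<delta> q s) {s'. Q (sample s')} =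
      measure_pmf.prob (map_pmf sample (scan es n \<epsilon> \<delta> q s)) {S. Q S}"
    by (simp add: vimage_def)
  also have "map_pmf sample (scan es n \<epsilon> \<delta> q s) = map_pmf (\<lambda>f j. {a. f (j, a)})
      (Pi_pmf ({0..<q} \<times> arcs E (active s)) False
       (\<lambda>x. bernoulli_pmf (level_prob n \<epsilon> \<delta> (deg_bound s) (fst x))))"
    unfolding scan_def fold_read_edge
    by (subst map_sample_fold)
      (use distinct_arc_list[OF assms] set_arc_list[OF assms(2)] in simp_all)
  finally show ?thesis by (simp add: vimage_def)
qed

lemma scan_support:
  assumes "s' \<in> set_pmf (scan es n \<epsilon> \<delta> q s)"
  obtains S m where "s' = s\<lparr>sample := S, level := 0, passes := Suc (passes s), peak := m\<rparr>"
    and "m \<le> max (peak s) (words q s')"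
proof -
  have "sampling_ext q (s\<lparr>sample := (\<lambda>_. {}), level := 0, passes := Suc (passes s)\<rparr>) s'"
    using assms unfolding scan_def fold_read_edge by (rule sampling_ext_fold)
  then obtain S m where "s' = s\<lparr>sample := (\<lambda>_. {}), level := 0, passes := Suc (passes s)\<rparr>\<lparr>sample := S, peak := m\<rparr>"
    and "peak s' \<le> max (peak (s\<lparr>sample := (\<lambda>_. {}), level := 0, passes := Suc (passes s)\<rparr>)) (words q s')"
    unfolding sampling_ext_def by blast
  then show thesis using that[of m S] by simp
qed

section \<open>Degrees and degree-dominating lists\<close>

abbreviation deg_in :: "'v set set \<Rightarrow> 'v set \<Rightarrow> 'v \<Rightarrow> nat" where
  "deg_in E W v \<equiv> vertex_degree (induced_edges E W) v"

lemma simple_graph_finite: "simple_graph V E \<Longrightarrow> finite V \<and> finite E"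
  by (auto simp: simple_graph_def intro: finite_subset[of E "Pow V"])

lemma deg_in_eq_card:
  assumes "simple_graph V E" "v \<in> W"
  shows "deg_in E W v = card {w \<in> W. {v, w} \<in> E}"
proof -
  have two: "card e = 2" if "e \<in> E" for e using assms that by (simp add: simple_graph_def)
  have "{e \<in> induced_edges E W. v \<in> e} = (\<lambda>w. {v, w}) ` {w \<in> W. {v, w} \<in> E}"
  proof (intro equalityI subsetI)
    fix e assume e: "e \<in> {e \<in> induced_edges E W. v \<in> e}"
    then have "card e = 2" "v \<in> e" using two by (auto simp: induced_edges_def)
    then obtain w where "e = {v, w}" by (auto simp: card_2_iff)
    then show "e \<in> (\<lambda>w. {v, w}) ` {w \<in> W. {v, w} \<in> E}" using e by (auto simp: induced_edges_def)
  qed (use assms in \<open>auto simp: induced_edges_def\<close>)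
  moreover have "inj_on (\<lambda>w. {v, w}) {w \<in> W. {v, w} \<in> E}"
    by (auto simp: inj_on_def doubleton_eq_iff)
  ultimately show ?thesis by (simp add: vertex_degree_def card_image)
qed

lemma deg_in_mono: "finite E \<Longrightarrow> W \<subseteq> W' \<Longrightarrow> deg_in E W v \<le> deg_in E W' v"
  unfolding vertex_degree_def by (intro card_mono) (auto simp: induced_edges_def)

lemma deg_in_less_card:
  assumes "simple_graph V E" "v \<in> W" "finite W"
  shows "deg_in E W v < card W"
proof -
  have "{v} \<notin> E" using assms by (auto simp: simple_graph_def)
  then have "{w \<in> W. {v, w} \<in> E} \<subseteq> W - {v}" by auto
  then have "{w \<in> W. {v, w} \<in> E} \<subset> W" using assms by auto
  then show ?thesis using psubset_card_mono[OF assms(3)] by (simp add: deg_in_eq_card[OF assms(1,2)])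
qed

lemma card_arcs:
  assumes "simple_graph V E" "finite U"
  shows "card (arcs E U) = (\<Sum>v\<in>U. deg_in E U v)"
proof -
  have "arcs E U = (SIGMA v:U. {w \<in> U. {v, w} \<in> E})" by (auto simp: arcs_def)
  then have "card (arcs E U) = (\<Sum>v\<in>U. card {w \<in> U. {v, w} \<in> E})" using assms(2) by simp
  then show ?thesis using deg_in_eq_card[OF assms(1)] by simp
qed

definition dominates :: "real \<Rightarrow> 'v set set \<Rightarrow> 'v set \<Rightarrow> 'v \<Rightarrow> bool" where
  "dominates \<theta> E W v \<longleftrightarrow> (1 \<le> deg_in E W v \<longrightarrow>
     (\<forall>u\<in>W. \<theta> * real (deg_in E W u) \<le> real (deg_in E W v)))"

text \<open>The comparison is with \<open>V\<close> rather than with the rest of the list, so the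
  condition makes sense for an unfinished list and later appends cannot spoil it. If the list
  enumerates \<open>V\<close>, then \<open>V - set ys\<close> is the vertex set of G(v).\<close>

definition dd_prefix :: "real \<Rightarrow> 'v set \<Rightarrow> 'v set set \<Rightarrow> 'v list \<Rightarrow> bool" where
  "dd_prefix \<theta> V E xs \<longleftrightarrow> (\<forall>ys v zs. xs = ys @ v # zs \<longrightarrow> dominates \<theta> E (V - set ys) v)"

section \<open>The linear order given by a list\<close>

lemma list_order_nth:
  assumes "distinct xs" "i < length xs" "j < length xs"
  shows "(xs ! i, xs ! j) \<in> list_order xs \<longleftrightarrow> i \<le> j"
proof
  assume "(xs ! i, xs ! j) \<in> list_order xs"
  then obtain i' j' where *: "xs ! i = xs ! i'" "xs ! j = xs ! j'" "i' \<le> j'" "j' < length xs"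
    unfolding list_order_def by blast
  then have "i' = i" "j' = j"
    using assms nth_eq_iff_index_eq[of xs i i'] nth_eq_iff_index_eq[of xs j j'] by simp_all
  then show "i \<le> j" using * by simp
qed (use assms in \<open>auto simp: list_order_def\<close>)

lemma list_orderE:
  assumes "(x, y) \<in> list_order xs"
  obtains i j where "x = xs ! i" "y = xs ! j" "i \<le> j" "j < length xs"
  using assms unfolding list_order_def by blast

lemma linear_order_on_list_order:
  assumes "distinct xs"
  shows "linear_order_on (set xs) (list_order xs)"
proof -
  have "list_order xs \<subseteq> set xs \<times> set xs" by (auto simp: list_order_def)
  moreover have "refl_on (set xs) (list_order xs)"
  proof (rule refl_onI)
    fix x assume "x \<in> set xs"
    then obtain i where "x = xs ! i" "i < length xs" by (auto simp: in_set_conv_nth)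
    then show "(x, x) \<in> list_order xs" using list_order_nth[OF assms, of i i] by simp
  qed
  moreover have "trans (list_order xs)"
  proof (rule transI)
    fix x y z assume xy: "(x, y) \<in> list_order xs" and yz: "(y, z) \<in> list_order xs"
    obtain i j where ij: "x = xs ! i" "y = xs ! j" "i \<le> j" "j < length xs"
      using xy by (rule list_orderE)
    obtain j' k where jk: "y = xs ! j'" "z = xs ! k" "j' \<le> k" "k < length xs"
      using yz by (rule list_orderE)
    have "j' = j" using ij jk nth_eq_iff_index_eq[OF assms, of j' j] by simp
    then show "(x, z) \<in> list_order xs" using ij jk list_order_nth[OF assms, of i k] by simp
  qed
  moreover have "antisym (list_order xs)"
  proof (rule antisymI)
    fix x y assume xy: "(x, y) \<in> list_order xs" and yx: "(y, x) \<in> list_order xs"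
    obtain i j where ij: "x = xs ! i" "y = xs ! j" "i \<le> j" "j < length xs"
      using xy by (rule list_orderE)
    then have "j \<le> i" using yx list_order_nth[OF assms, of j i] by simp
    then show "x = y" using ij by simp
  qed
  moreover have "total_on (set xs) (list_order xs)"
  proof (rule total_onI)
    fix x y assume "x \<in> set xs" "y \<in> set xs"
    then obtain i j where "x = xs ! i" "y = xs ! j" "i < length xs" "j < length xs"
      by (auto simp: in_set_conv_nth)
    then show "(x, y) \<in> list_order xs \<or> (y, x) \<in> list_order xs"
      using list_order_nth[OF assms, of i j] list_order_nth[OF assms, of j i] nat_le_linear[of i j] by simp
  qed
  ultimately show ?thesis
    by (simp add: linear_order_on_def partial_order_on_def preorder_on_def)
qed

lemma list_order_successors:
  assumes "distinct (ys @ v # zs)"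
  shows "{u \<in> set (ys @ v # zs). (v, u) \<in> list_order (ys @ v # zs)} = set (ys @ v # zs) - set ys"
proof -
  let ?xs = "ys @ v # zs"
  have v: "v = ?xs ! length ys" by simp
  have "(v, ?xs ! j) \<in> list_order ?xs \<longleftrightarrow> ?xs ! j \<notin> set ys" if j: "j < length ?xs" for j
  proof -
    have "(v, ?xs ! j) \<in> list_order ?xs \<longleftrightarrow> length ys \<le> j"
      using list_order_nth[OF assms, of "length ys" j] j by simp
    also have "\<dots> \<longleftrightarrow> ?xs ! j \<notin> set ys"
    proof
      assume "length ys \<le> j"
      then have "?xs ! j = (v # zs) ! (j - length ys)" "j - length ys < length (v # zs)"
        using j by (simp_all add: nth_append less_diff_conv2)
      then have "?xs ! j \<in> set (v # zs)" by (metis nth_mem)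
      then show "?xs ! j \<notin> set ys" using assms by auto
    next
      assume "?xs ! j \<notin> set ys"
      then show "length ys \<le> j" using nth_mem[of j ys] by (cases "j < length ys") (simp_all add: nth_append)
    qed
    finally show ?thesis .
  qed
  then have "(v, u) \<in> list_order ?xs \<longleftrightarrow> u \<notin> set ys" if "u \<in> set ?xs" for u
    using that unfolding in_set_conv_nth[of u ?xs] by blast
  then show ?thesis by blast
qed

lemma dd_order_list_order:
  assumes "distinct xs" "dd_prefix \<theta> (set xs) E xs"
  shows "dd_order \<theta> (set xs) E (list_order xs)"
proof -
  have "dominates \<theta> E {u \<in> set xs. (v, u) \<in> list_order xs} v" if v: "v \<in> set xs" for v
  proof -
    obtain ys zs where xs: "xs = ys @ v # zs" using v by (meson split_list)
    then have "dominates \<theta> E (set xs - set ys) v" using assms(2) by (simp add: dd_prefix_def)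
    then show ?thesis using list_order_successors[of ys v zs] assms(1) xs by simp
  qed
  then show ?thesis
    using linear_order_on_list_order[OF assms(1)]
    by (simp add: dd_order_def dominates_def Let_def)
qed

lemma dd_prefix_append:
  assumes "dd_prefix \<theta> V E xs" "\<And>us v ws. ys = us @ v # ws \<Longrightarrow> dominates \<theta> E (V - set xs - set us) v"
  shows "dd_prefix \<theta> V E (xs @ ys)"
  unfolding dd_prefix_def
proof (intro allI impI)
  fix us v ws assume "xs @ ys = us @ v # ws"
  then consider us' where "us = xs @ us'" "ys = us' @ v # ws" | vs where "xs = us @ v # vs"
    by (auto simp: append_eq_append_conv2 append_eq_Cons_conv)
  then show "dominates \<theta> E (V - set us) v"
  proof cases
    case 1
    moreover have "V - set (xs @ us') = V - set xs - set us'" by auto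
    ultimately show ?thesis using assms(2) by simp
  next
    case 2
    then show ?thesis using assms(1) by (auto simp: dd_prefix_def)
  qed
qed

text \<open>\<theta> scales every degree down to at most 1, and the condition only concerns vertices
  of degree at least 1.\<close>

lemma dominates_of_le_one:
  assumes "simple_graph V E" "W \<subseteq> V" "0 \<le> \<theta>" "\<theta> * real (card V) \<le> 1"
  shows "dominates \<theta> E W v"
proof -
  have fin: "finite V" using assms by (simp add: simple_graph_def)
  have "\<theta> * real (deg_in E W u) \<le> 1" if "u \<in> W" for u
  proof -
    have "deg_in E W u \<le> card V"
      using deg_in_less_card[OF assms(1) that] card_mono[OF fin assms(2)] finite_subset[OF assms(2) fin] by simp
    then have "\<theta> * real (deg_in E W u) \<le> \<theta> * real (card V)" using assms by (intro mult_left_mono) auto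
    then show ?thesis using assms by simp
  qed
  then show ?thesis by (fastforce simp: dominates_def)
qed

section \<open>Rounds without misjudged vertices\<close>

locale dd_instance =
  fixes V :: "'v set" and E es enum and \<epsilon> \<delta> c :: real
  assumes graph: "simple_graph V E" and stream: "edge_stream E es"
    and enum: "vertex_enumeration V enum"
    and eps: "0 < \<epsilon>" and del: "0 < \<delta>" "\<delta> < 1" and c: "0 < c"
    and levels: "1 \<le> num_levels (card V) \<epsilon> c"
begin

abbreviation "n \<equiv> card V"
abbreviation "q \<equiv> num_levels n \<epsilon> c"
abbreviation "T \<equiv> num_rounds n \<epsilon>"
abbreviation "\<alpha> \<equiv> 1 + \<epsilon> / 2"
abbreviation "\<theta> \<equiv> 1 / (1 + \<epsilon>)"
abbreviation "deg \<equiv> deg_in E"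

definition log_factor :: real where
  "log_factor = ln (2 * real n * T / \<delta>)"

text \<open>The expected number of arcs that survive among \<Delta>_j arcs when p_j < 1, the same on
  every level. Degree bounds above it are sampled, those below it keep every arc.\<close>

definition rate :: real where
  "rate = 3 * (1 + \<epsilon>) / (eps_hat \<epsilon>)\<^sup>2 * log_factor"

text \<open>A pass divides the degree bound by \<open>\<alpha> ^ q\<close>, and \<alpha> powr T =
  n.\<close>

definition max_passes :: nat where
  "max_passes = nat \<lceil>T / q\<rceil>"

definition arc_bound :: real where
  "arc_bound = 4 * (real n powr (1 + c) * max 0 rate / \<epsilon>) + ln (2 * real max_passes / \<delta>)"

definition peak_bound :: real where
  "peak_bound = 3 * real n + 2 * arc_bound + 2 * real q + 16"

definition small :: "'v dd_state \<Rightarrow> bool" where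
  "small s \<longleftrightarrow> real (\<Sum>j<q. card (sample s j)) \<le> arc_bound \<and> real (peak s) \<le> peak_bound"

text \<open>\<open>W\<close> holds the vertices not yet listed: the set U between rounds, the set H
  during a round.\<close>

definition valid_list :: "'v list \<Rightarrow> 'v set \<Rightarrow> bool" where
  "valid_list xs W \<longleftrightarrow> W \<subseteq> V \<and> set xs = V - W \<and> distinct xs \<and> (1 \<le> T \<longrightarrow> dd_prefix \<theta> V E xs)"

lemma finV: "finite V" and finE: "finite E"
  using simple_graph_finite[OF graph] by auto

lemma valid_list_length: "valid_list xs W \<Longrightarrow> length xs \<le> n"
  unfolding valid_list_def using finV by (metis Diff_subset card_mono distinct_card)

lemma words_le:
  assumes "small s" "valid_list (order s) W" "active s \<subseteq> V" "rest s \<subseteq> V"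
  shows "real (words q s) \<le> peak_bound"
proof -
  have "real (\<Sum>j<q. 2 * card (sample s j)) \<le> 2 * arc_bound"
    using assms(1) by (simp add: small_def sum_distrib_left[symmetric])
  moreover have "length (order s) \<le> n" "card (active s) \<le> n" "card (rest s) \<le> n"
    using valid_list_length[OF assms(2)] card_mono[OF finV] assms by auto
  moreover have "words q s = length (order s) + card (active s) + card (rest s)
     + (\<Sum>j<q. 2 * card (sample s j)) + 2 * q + 16" by (simp add: words_def)
  ultimately show ?thesis unfolding peak_bound_def by linarith
qed

lemma small_charge:
  assumes "small s" "valid_list (order s) W" "active s \<subseteq> V" "rest s \<subseteq> V"
  shows "small (charge q s)"
  using words_le[OF assms] assms(1) by (simp add: small_def charge_def max_def)

text \<open>Together with \<open>strip\<close> and \<open>active_at\<close> this replays the peeling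
  on bare vertex sets, as a function of the samples \<open>S\<close>. The replay ignores the exit
  tests of the loop and is thus defined on all levels of a pass.\<close>

definition appended :: "real \<Rightarrow> (nat \<Rightarrow> ('v \<times> 'v) set) \<Rightarrow> nat \<Rightarrow> 'v set \<Rightarrow> 'v \<Rightarrow> bool" where
  "appended \<Delta> S i H v \<longleftrightarrow> level_bound \<epsilon> \<Delta> i / (1 + 3 * \<epsilon> / 4)
     \<le> 1 / level_prob n \<epsilon> \<delta> \<Delta> i * real (card {w \<in> H. (v, w) \<in> S i})"

definition strip :: "real \<Rightarrow> (nat \<Rightarrow> ('v \<times> 'v) set) \<Rightarrow> nat \<Rightarrow> 'v \<Rightarrow> 'v set \<Rightarrow> 'v set" where
  "strip \<Delta> S i v H = (if appended \<Delta> S i H v then H - {v} else H)"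

primrec active_at :: "nat \<Rightarrow> 'v set \<Rightarrow> real \<Rightarrow> (nat \<Rightarrow> ('v \<times> 'v) set) \<Rightarrow> nat \<Rightarrow> 'v set" where
  "active_at k U \<Delta> S 0 = U"
| "active_at k U \<Delta> S (Suc i) = fold (strip \<Delta> S i) (enum k i (active_at k U \<Delta> S i)) (active_at k U \<Delta> S i)"

text \<open>Between the two thresholds either decision is harmless: a vertex that is kept meets the
  next degree bound, and one that is appended dominates.\<close>

definition misjudged :: "real \<Rightarrow> (nat \<Rightarrow> ('v \<times> 'v) set) \<Rightarrow> nat \<Rightarrow> 'v set \<Rightarrow> 'v \<Rightarrow> bool" where
  "misjudged \<Delta> S i H v \<longleftrightarrow>
     level_bound \<epsilon> \<Delta> i / \<alpha> < real (deg H v) \<and> \<not> appended \<Delta> S i H v \<or>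
     real (deg H v) < level_bound \<epsilon> \<Delta> i / (1 + \<epsilon>) \<and> appended \<Delta> S i H v"

definition misjudges :: "nat \<Rightarrow> 'v set \<Rightarrow> real \<Rightarrow> (nat \<Rightarrow> ('v \<times> 'v) set) \<Rightarrow> nat \<Rightarrow> 'v \<Rightarrow> bool" where
  "misjudges k U \<Delta> S i v \<longleftrightarrow> (\<exists>ys zs. enum k i (active_at k U \<Delta> S i) = ys @ v # zs \<and>
     misjudged \<Delta> S i (fold (strip \<Delta> S i) ys (active_at k U \<Delta> S i)) v)"

lemma strip_subset: "strip \<Delta> S i v H \<subseteq> H"
  by (auto simp: strip_def)

lemma fold_strip_subset: "fold (strip \<Delta> S i) vs H \<subseteq> H"
  by (induction vs arbitrary: H) (auto dest: subsetD[OF strip_subset])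

lemma active_at_subset: "active_at k U \<Delta> S i \<subseteq> U"
  by (induction i) (auto dest: subsetD[OF fold_strip_subset])

text \<open>A vertex that survives was rightly kept at its turn, when its degree was already below
  the next bound; later removals only lower that degree.\<close>

lemma deg_after_strip:
  assumes "\<And>ys v zs. vs = ys @ v # zs \<Longrightarrow> \<not> misjudged \<Delta> S i (fold (strip \<Delta> S i) ys H) v"
    and v: "v \<in> set vs" "v \<in> fold (strip \<Delta> S i) vs H"
  shows "real (deg (fold (strip \<Delta> S i) vs H) v) \<le> level_bound \<epsilon> \<Delta> i / \<alpha>"
proof -
  obtain ys zs where vs: "vs = ys @ v # zs" using v(1) by (meson split_list)
  let ?H = "fold (strip \<Delta> S i) ys H"
  have sub: "fold (strip \<Delta> S i) vs H \<subseteq> strip \<Delta> S i v ?H"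
    using fold_strip_subset[of \<Delta> S i zs] by (simp add: vs)
  then have "\<not> appended \<Delta> S i ?H v" using v(2) by (auto simp: strip_def)
  then have "real (deg ?H v) \<le> level_bound \<epsilon> \<Delta> i / \<alpha>"
    using assms(1)[OF vs] by (auto simp: misjudged_def)
  moreover have "deg (fold (strip \<Delta> S i) vs H) v \<le> deg ?H v"
    using sub strip_subset by (intro deg_in_mono[OF finE]) blast
  ultimately show ?thesis by linarith
qed

definition round_inv where
  "round_inv i k \<Delta> S U s \<longleftrightarrow> level s = i \<and> passes s = k \<and> deg_bound s = \<Delta> \<and> sample s = S \<and>
     active s = U \<and> U \<subseteq> V \<and> rest s \<subseteq> U \<and> valid_list (order s) (rest s) \<and>
     (1 \<le> T \<longrightarrow> (\<forall>u\<in>rest s. real (deg (rest s) u) \<le> level_bound \<epsilon> \<Delta> i)) \<and> small s"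

text \<open>\<open>rest s\<close> is what the list has left over, hence the vertex set of G(v) for
  the vertex about to be appended. All degrees in it obey the level bound, and a rightly appended
  vertex has at least 1 / (1 + \<epsilon>) times that bound.\<close>

lemma process_vertex_step:
  assumes inv: "round_inv i k \<Delta> S U s" and v: "v \<in> rest s"
    and good: "1 \<le> T \<Longrightarrow> \<not> misjudged \<Delta> S i (rest s) v"
  shows "round_inv i k \<Delta> S U (process_vertex n \<epsilon> \<delta> q v s)"
    "rest (process_vertex n \<epsilon> \<delta> q v s) = strip \<Delta> S i v (rest s)"
proof -
  let ?s = "if appended \<Delta> S i (rest s) v
    then s\<lparr>order := order s @ [v], rest := rest s - {v}\<rparr> else s"
  have eq: "process_vertex n \<epsilon> \<delta> q v s = charge q ?s"
    using inv by (auto simp: process_vertex_def appended_def round_inv_def Let_def)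
  show "rest (process_vertex n \<epsilon> \<delta> q v s) = strip \<Delta> S i v (rest s)"
    unfolding eq by (simp add: charge_def strip_def)
  have sub: "rest ?s \<subseteq> rest s" by auto
  have vl: "valid_list (order ?s) (rest ?s)"
  proof (cases "appended \<Delta> S i (rest s) v")
    case True
    have vs: "valid_list (order s) (rest s)" using inv by (simp add: round_inv_def)
    then have rest: "V - set (order s) = rest s" by (auto simp: valid_list_def)
    have "dominates \<theta> E (rest s) v" if T: "1 \<le> T"
    proof -
      have d: "level_bound \<epsilon> \<Delta> i / (1 + \<epsilon>) \<le> real (deg (rest s) v)"
        using good[OF T] True by (auto simp: misjudged_def)
      have "\<theta> * real (deg (rest s) u) \<le> real (deg (rest s) v)" if "u \<in> rest s" for u
      proof -
        have "real (deg (rest s) u) \<le> level_bound \<epsilon> \<Delta> i"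
          using inv T that by (auto simp: round_inv_def)
        then have "real (deg (rest s) u) / (1 + \<epsilon>) \<le> level_bound \<epsilon> \<Delta> i / (1 + \<epsilon>)"
          using eps by (intro divide_right_mono) auto
        then show ?thesis using d by simp
      qed
      then show ?thesis by (simp add: dominates_def)
    qed
    then have "1 \<le> T \<longrightarrow> dd_prefix \<theta> V E (order s @ [v])"
      using vs rest by (auto simp: valid_list_def Cons_eq_append_conv intro!: dd_prefix_append)
    then show ?thesis using vs v True by (auto simp: valid_list_def)
  qed (use inv in \<open>simp add: round_inv_def\<close>)
  have deg: "1 \<le> T \<longrightarrow> (\<forall>u\<in>rest ?s. real (deg (rest ?s) u) \<le> level_bound \<epsilon> \<Delta> i)"
  proof (intro impI ballI)
    fix u assume "1 \<le> T" "u \<in> rest ?s"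
    then have "real (deg (rest s) u) \<le> level_bound \<epsilon> \<Delta> i" using inv sub by (auto simp: round_inv_def)
    then show "real (deg (rest ?s) u) \<le> level_bound \<epsilon> \<Delta> i"
      using deg_in_mono[OF finE sub, of u] by linarith
  qed
  have sm: "small ?s" using inv by (auto simp: small_def round_inv_def)
  have act: "active ?s \<subseteq> V" "rest ?s \<subseteq> V" using inv sub by (auto simp: round_inv_def)
  have "small (charge q ?s)" by (rule small_charge[OF sm vl act])
  then show "round_inv i k \<Delta> S U (process_vertex n \<epsilon> \<delta> q v s)"
    unfolding eq using inv vl deg sub by (simp add: round_inv_def charge_def split del: if_split) (auto split: if_splits)
qed

lemma fold_process_vertex:
  assumes "round_inv i k \<Delta> S U s" "set vs \<subseteq> rest s" "distinct vs"
    and "1 \<le> T \<Longrightarrow> \<forall>ys v zs. vs = ys @ v # zs \<longrightarrow> \<not> misjudged \<Delta> S i (fold (strip \<Delta> S i) ys (rest s)) v"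
  shows "round_inv i k \<Delta> S U (fold (process_vertex n \<epsilon> \<delta> q) vs s) \<and>
    rest (fold (process_vertex n \<epsilon> \<delta> q) vs s) = fold (strip \<Delta> S i) vs (rest s)"
  using assms
proof (induction vs arbitrary: s)
  case (Cons v vs)
  let ?s = "process_vertex n \<epsilon> \<delta> q v s"
  have good: "\<not> misjudged \<Delta> S i (rest s) v" if "1 \<le> T"
    using Cons.prems(4)[OF that, rule_format, of "[]" v vs] by simp
  have step: "round_inv i k \<Delta> S U ?s" "rest ?s = strip \<Delta> S i v (rest s)"
    using process_vertex_step[OF Cons.prems(1) _ good] Cons.prems(2) by auto
  have "set vs \<subseteq> rest ?s" using Cons.prems by (auto simp: step strip_def)
  moreover have "\<forall>ys u zs. vs = ys @ u # zs \<longrightarrow> \<not> misjudged \<Delta> S i (fold (strip \<Delta> S i) ys (rest ?s)) u"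
    if "1 \<le> T"
  proof (intro allI impI)
    fix ys u zs assume "vs = ys @ u # zs"
    then show "\<not> misjudged \<Delta> S i (fold (strip \<Delta> S i) ys (rest ?s)) u"
      using Cons.prems(4)[OF that, rule_format, of "v # ys" u zs] by (simp add: step)
  qed
  ultimately show ?case using Cons.IH[OF step(1)] Cons.prems(3) by (simp add: step)
qed simp

text \<open>The case i = q is separate because the last round of a pass also renews
  \<open>deg_bound\<close>; the degree bound in terms of the old \<Delta> stays the same
  formula.\<close>

definition level_inv where
  "level_inv i k \<Delta> S U s \<longleftrightarrow> (if i < q then level s = i \<and> deg_bound s = \<Delta> else level s = q \<and> deg_bound s = \<Delta> / \<alpha> ^ q) \<and>
     passes s = k \<and> sample s = S \<and> active s = active_at k U \<Delta> S i \<and> U \<subseteq> V \<and> rest s \<subseteq> V \<and>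
     valid_list (order s) (active s) \<and>
     (1 \<le> T \<longrightarrow> (\<forall>u\<in>active s. real (deg (active s) u) \<le> level_bound \<epsilon> \<Delta> i)) \<and> small s"

definition finished :: "nat \<Rightarrow> 'v dd_state \<Rightarrow> bool" where
  "finished k s \<longleftrightarrow> active s = {} \<and> valid_list (order s) {} \<and> passes s \<le> k \<and> small s"

text \<open>One turn of the loop without a scan. It idles once \<open>active\<close> is empty, so a
  pass can be treated as exactly q steps even if the run ends earlier.\<close>

definition level_step :: "'v dd_state \<Rightarrow> 'v dd_state" where
  "level_step s = (if active s = {} then s
     else if current_bound \<epsilon> q s < 1 then append_rest enum q s
     else next_level \<epsilon> q (peel enum n \<epsilon> \<delta> q s))"

lemma enum_set: "U \<subseteq> V \<Longrightarrow> set (enum k i U) = U" and enum_distinct: "U \<subseteq> V \<Longrightarrow> distinct (enum k i U)"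
  using enum by (auto simp: vertex_enumeration_def)

text \<open>Vertices without remaining neighbours satisfy the domination condition vacuously, so
  they may be listed in any order.\<close>

lemma finished_append_rest:
  assumes vl: "valid_list (order s) (active s)" and sm: "small s" and "passes s \<le> k"
    and deg: "1 \<le> T \<Longrightarrow> \<forall>u\<in>active s. deg (active s) u = 0"
  shows "finished k (append_rest enum q s)"
proof -
  let ?vs = "enum (passes s) (level s) (active s)"
  have act: "active s \<subseteq> V" using vl by (simp add: valid_list_def)
  have "dominates \<theta> E (V - set (order s) - set us) v"
    if T: "1 \<le> T" and vs: "?vs = us @ v # ws" for us v ws
  proof -
    have W: "V - set (order s) = active s" using vl by (auto simp: valid_list_def)
    have "v \<in> active s" using enum_set[OF act, of "passes s" "level s"] vs by auto
    then have "deg (active s - set us) v = 0"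
      using deg[OF T] deg_in_mono[OF finE Diff_subset, of "active s" "set us" v] by simp
    then show ?thesis by (simp add: dominates_def W)
  qed
  then have "1 \<le> T \<longrightarrow> dd_prefix \<theta> V E (order s @ ?vs)"
    using vl by (intro impI dd_prefix_append) (auto simp: valid_list_def)
  then have vl': "valid_list (order s @ ?vs) {}"
    using vl enum_set[OF act] enum_distinct[OF act] by (auto simp: valid_list_def)
  let ?s = "s\<lparr>order := order s @ ?vs, active := {}, rest := {}\<rparr>"
  have "small ?s" using sm by (simp add: small_def)
  then have "small (charge q ?s)" by (rule small_charge) (use vl' in auto)
  then show ?thesis using vl' assms(3) by (simp add: finished_def append_rest_def charge_def)
qed

lemma level_step_inv:
  assumes inv: "level_inv i k \<Delta> S U s" and i: "i < q"
    and good: "\<And>v. 1 \<le> T \<Longrightarrow> \<not> misjudges k U \<Delta> S i v"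
  shows "finished k (level_step s) \<or> level_inv (Suc i) k \<Delta> S U (level_step s)"
proof -
  have lev: "level s = i" "deg_bound s = \<Delta>" "passes s = k" "sample s = S"
    and act: "active s = active_at k U \<Delta> S i" and U: "U \<subseteq> V"
    and vl: "valid_list (order s) (active s)" and sm: "small s"
    and deg: "1 \<le> T \<Longrightarrow> \<forall>u\<in>active s. real (deg (active s) u) \<le> level_bound \<epsilon> \<Delta> i"
    using inv i by (auto simp: level_inv_def)
  have actV: "active s \<subseteq> V" using act active_at_subset U by blast
  have cb: "current_bound \<epsilon> q s = level_bound \<epsilon> \<Delta> i" using lev i by (simp add: current_bound_def)
  consider "active s = {}" | "active s \<noteq> {}" "current_bound \<epsilon> q s < 1"
    | "active s \<noteq> {}" "\<not> current_bound \<epsilon> q s < 1" by blast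
  then show ?thesis
  proof cases
    case 1
    then show ?thesis using vl sm lev by (simp add: level_step_def finished_def)
  next
    case 2
    have "\<forall>u\<in>active s. deg (active s) u = 0" if "1 \<le> T"
      using deg[OF that] 2 cb by fastforce
    then show ?thesis using 2 finished_append_rest[OF vl sm] lev by (simp add: level_step_def)
  next
    case 3
    let ?s = "charge q (s\<lparr>rest := active s\<rparr>)"
    let ?vs = "enum k i (active s)"
    have "small (s\<lparr>rest := active s\<rparr>)" using sm by (simp add: small_def)
    then have "small ?s" by (rule small_charge[where W = "active s"]) (use vl actV in auto)
    then have r: "round_inv i k \<Delta> S (active s) ?s"
      using lev vl actV deg by (simp add: round_inv_def charge_def)
    have rest: "rest ?s = active s" by (simp add: charge_def)
    have nm: "\<forall>ys v zs. ?vs = ys @ v # zs \<longrightarrow> \<not> misjudged \<Delta> S i (fold (strip \<Delta> S i) ys (active s)) v"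
      if "1 \<le> T" using good[OF that] by (auto simp: misjudges_def act)
    let ?t = "fold (process_vertex n \<epsilon> \<delta> q) ?vs ?s"
    have t: "round_inv i k \<Delta> S (active s) ?t" "rest ?t = fold (strip \<Delta> S i) ?vs (active s)"
      using fold_process_vertex[OF r, of ?vs] nm enum_set[OF actV] enum_distinct[OF actV]
      by (auto simp: rest)
    have peel: "peel enum n \<epsilon> \<delta> q s = ?t\<lparr>active := rest ?t\<rparr>"
      using lev by (simp add: peel_def Let_def)
    have dg: "real (deg (rest ?t) u) \<le> level_bound \<epsilon> \<Delta> (Suc i)" if "1 \<le> T" "u \<in> rest ?t" for u
    proof -
      have "u \<in> set ?vs" using that(2) t(2) fold_strip_subset enum_set[OF actV] by fastforce
      then show ?thesis
        using deg_after_strip[of ?vs \<Delta> S i "active s" u] nm[OF that(1)] that(2) t(2)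
        by (simp add: level_bound_def field_simps)
    qed
    have next_lev: "level_inv (Suc i) k \<Delta> S U (next_level \<epsilon> q (?t\<lparr>active := rest ?t\<rparr>))"
      using t(1) i dg U act t(2) finite_subset
      by (auto simp: next_level_def round_inv_def level_inv_def small_def level_bound_def field_simps
          power_Suc[symmetric] simp del: power_Suc)
    then show ?thesis using 3 by (simp add: level_step_def peel)
  qed
qed

lemma level_steps_inv:
  assumes "level_inv 0 k \<Delta> S U s" "m \<le> q"
    and "\<And>i v. 1 \<le> T \<Longrightarrow> i < q \<Longrightarrow> \<not> misjudges k U \<Delta> S i v"
  shows "finished k ((level_step ^^ m) s) \<or> level_inv m k \<Delta> S U ((level_step ^^ m) s)"
  using assms(2)
proof (induction m)
  case (Suc m)
  then consider "finished k ((level_step ^^ m) s)" | "level_inv m k \<Delta> S U ((level_step ^^ m) s)" by auto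
  then show ?case
  proof cases
    case 1
    then have "level_step ((level_step ^^ m) s) = (level_step ^^ m) s"
      by (simp add: level_step_def finished_def)
    then show ?thesis using 1 by simp
  next
    case 2
    then show ?thesis using level_step_inv[OF 2] Suc.prems assms(3) by simp
  qed
qed (use assms in simp)


section \<open>Failure probabilities\<close>

text \<open>For n = 0 or n = 1 the number n powr c is 0 or 1, and \<open>ln\<close> sends both to 0,
  so there would be no level.\<close>

lemma n_ge_2: "2 \<le> n"
proof (rule ccontr)
  assume "\<not> 2 \<le> n"
  then have "n = 0 \<or> n = 1" by linarith
  then have "log \<alpha> (real n powr c) = 0" by (auto simp: log_def)
  then show False using levels by (simp add: num_levels_def)
qed

lemma T_pos: "0 < T"
  using n_ge_2 eps by (simp add: num_rounds_def)

lemma eps_hat_bounds: "0 < eps_hat \<epsilon>" "eps_hat \<epsilon> < 1 / 3"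
  using eps by (simp_all add: eps_hat_def field_simps)

text \<open>The defining equations of h = \<open>eps_hat\<close> and \<beta> = 3 \<epsilon> / 4: the
  one decision threshold 1 / (1 + \<beta>) is the lower deviation (1 - h) / \<alpha> and the upper
  deviation (1 + h) / (1 + \<epsilon>). Adding them shows why \<beta> is the mean of \<epsilon> / 2
  and \<epsilon>.\<close>

lemma eps_hat_minus: "1 - eps_hat \<epsilon> = \<alpha> / (1 + 3 * \<epsilon> / 4)"
  and eps_hat_plus: "1 + eps_hat \<epsilon> = (1 + \<epsilon>) / (1 + 3 * \<epsilon> / 4)"
proof -
  have "4 + 3 * \<epsilon> \<noteq> 0" "1 + 3 * \<epsilon> / 4 = (4 + 3 * \<epsilon>) / 4" using eps by auto
  then show "1 - eps_hat \<epsilon> = \<alpha> / (1 + 3 * \<epsilon> / 4)" "1 + eps_hat \<epsilon> = (1 + \<epsilon>) / (1 + 3 * \<epsilon> / 4)"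
    by (simp_all add: eps_hat_def field_simps)
qed

lemma rate_eq: "(eps_hat \<epsilon>)\<^sup>2 * rate = 3 * (1 + \<epsilon>) * log_factor"
  using eps_hat_bounds by (simp add: rate_def)

lemma level_prob_eq: "level_prob n \<epsilon> \<delta> \<Delta> j = min (rate / level_bound \<epsilon> \<Delta> j) 1"
  by (simp add: level_prob_def rate_def log_factor_def Let_def)

lemma log_factor_ge:
  assumes "1 \<le> T"
  shows "1 \<le> log_factor"
proof -
  \<comment> \<open>The argument of the logarithm is at least 4, more than e.\<close>
  have "2 * 2 * 1 \<le> 2 * real n * T" using n_ge_2 assms by (intro mult_mono) auto
  also have "\<dots> \<le> 2 * real n * T / \<delta>" using del T_pos mult_left_le[of \<delta> "2 * real n * T"]
    by (simp add: pos_le_divide_eq)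
  finally have "exp 1 \<le> 2 * real n * T / \<delta>" using exp_le by linarith
  then have "ln (exp 1) \<le> log_factor" unfolding log_factor_def
    by (intro ln_mono) (auto intro: less_le_trans[OF exp_gt_zero])
  then show ?thesis by simp
qed

lemma exp_minus_log_factor: "exp (- log_factor) = \<delta> / (2 * real n * T)"
proof -
  have "0 < 2 * real n * T / \<delta>" using n_ge_2 T_pos del by simp
  then show ?thesis by (simp add: log_factor_def exp_minus)
qed

text \<open>The rate is even at least 3 (1 + \<epsilon>). The bound \<alpha> later shows that
  sampling stops a full round before the degree bound reaches 1.\<close>

lemma rate_ge:
  assumes "1 \<le> T"
  shows "\<alpha> \<le> rate"
proof -
  have "(eps_hat \<epsilon>)\<^sup>2 \<le> 1" using eps_hat_bounds by (simp add: power_le_one)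
  moreover have pos: "0 < rate" using eps eps_hat_bounds log_factor_ge[OF assms] by (simp add: rate_def)
  ultimately have a: "(eps_hat \<epsilon>)\<^sup>2 * rate \<le> 1 * rate" by (intro mult_right_mono) auto
  have "3 * (1 + \<epsilon>) * 1 \<le> 3 * (1 + \<epsilon>) * log_factor"
    using log_factor_ge[OF assms] eps by (intro mult_left_mono) auto
  from order_trans[OF this a[unfolded rate_eq]] show ?thesis using eps by simp
qed

text \<open>Both tails are evaluated at the threshold degree. For the upper tail the mean is rate /
  (1 + \<epsilon>) and the exponent is exactly \<open>log_factor\<close>, which is the purpose of K
  = 1 + \<epsilon>; the exponent of the lower tail is larger by (1 + \<epsilon>) / \<alpha>. With p
  = 1 the count is exact, and the decision threshold lies between the two degrees.\<close>

lemma prob_estimate_misjudged: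
  assumes T: "1 \<le> T" and B: "finite B" "D \<subseteq> B" and x: "0 < x" and p: "p = min (rate / x) 1"
  shows "measure_pmf.prob (Pi_pmf B False (\<lambda>_. bernoulli_pmf p))
    {f. x / \<alpha> < real (card D) \<and> \<not> x / (1 + 3 * \<epsilon> / 4) \<le> 1 / p * real (card {y \<in> D. f y}) \<or>
        real (card D) < x / (1 + \<epsilon>) \<and> x / (1 + 3 * \<epsilon> / 4) \<le> 1 / p * real (card {y \<in> D. f y})}
    \<le> (if rate < x then exp (- log_factor) else 0)" (is "measure_pmf.prob ?P ?X \<le> _")
proof (cases "rate < x")
  case False
  then have p1: "p = 1" using p x by simp
  have "x / (1 + \<epsilon>) \<le> x / (1 + 3 * \<epsilon> / 4)" "x / (1 + 3 * \<epsilon> / 4) \<le> x / \<alpha>"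
    using eps x by (auto intro!: divide_left_mono)
  moreover have "{y \<in> D. f y} = D" if "f \<in> set_pmf ?P" for f
  proof -
    have "f y" if "y \<in> D" for y
    proof -
      have "f y \<in> set_pmf (bernoulli_pmf 1)"
        using \<open>f \<in> set_pmf ?P\<close> that B by (auto simp: set_Pi_pmf PiE_dflt_def p1)
      then show ?thesis by (cases "f y") (auto simp: set_pmf_iff)
    qed
    then show ?thesis by auto
  qed
  ultimately have "set_pmf ?P \<inter> ?X = {}" using p1 by fastforce
  then have "measure_pmf.prob ?P ?X = 0" by (simp only: measure_pmf_zero_iff)
  then show ?thesis using False by simp
next
  case True
  have r: "0 < rate" using rate_ge[OF T] eps by simp
  have pr: "p = rate / x" "0 < p" "p \<le> 1" "p * x = rate" using p True x r by auto
  let ?h = "eps_hat \<epsilon>" and ?N = "\<lambda>f. real (card {y \<in> D. f y})"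
  have thr: "x / (1 + 3 * \<epsilon> / 4) \<le> 1 / p * a \<longleftrightarrow> rate / (1 + 3 * \<epsilon> / 4) \<le> a" for a
  proof -
    have "x / (1 + 3 * \<epsilon> / 4) * p = rate / (1 + 3 * \<epsilon> / 4)" using pr(4) by (simp add: mult.commute)
    moreover have "x / (1 + 3 * \<epsilon> / 4) \<le> 1 / p * a \<longleftrightarrow> x / (1 + 3 * \<epsilon> / 4) * p \<le> a"
      using pos_le_divide_eq[OF pr(2), of "x / (1 + 3 * \<epsilon> / 4)" a] by simp
    ultimately show ?thesis by (simp only:)
  qed
  have cancel: "a / k * (t / a) = t / k" if "a \<noteq> 0" for a k t :: real using that by simp
  \<comment> \<open>The 3 in the sampling probability meets the 3 in the denominator of the Chernoff
    exponent.\<close>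
  have third: "3 * a * k / b / 3 = a * k / b" for a b k :: real by simp
  have le: "x / (1 + \<epsilon>) \<le> x / \<alpha>" using eps x by (auto intro!: divide_left_mono)
  have X: "x / \<alpha> < real (card D) \<and> \<not> rate / (1 + 3 * \<epsilon> / 4) \<le> ?N f \<or>
      real (card D) < x / (1 + \<epsilon>) \<and> rate / (1 + 3 * \<epsilon> / 4) \<le> ?N f" if "f \<in> ?X" for f
    using that unfolding mem_Collect_eq thr .
  consider "x / \<alpha> < real (card D)" | "real (card D) < x / (1 + \<epsilon>)" | "\<not> x / \<alpha> < real (card D)" "\<not> real (card D) < x / (1 + \<epsilon>)"
    by blast
  then show ?thesis
  proof cases
    case 1
    have eq: "(1 - ?h) * (rate / \<alpha>) = rate / (1 + 3 * \<epsilon> / 4)"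
      unfolding eps_hat_minus by (rule cancel) (use eps in simp)
    have "?X \<subseteq> {f. ?N f \<le> (1 - ?h) * (rate / \<alpha>)}"
    proof
      fix f assume "f \<in> ?X"
      from X[OF this] show "f \<in> {f. ?N f \<le> (1 - ?h) * (rate / \<alpha>)}"
        unfolding mem_Collect_eq eq using 1 le by linarith
    qed
    then have "measure_pmf.prob ?P ?X \<le> measure_pmf.prob ?P {f. ?N f \<le> (1 - ?h) * (rate / \<alpha>)}"
      by (intro measure_pmf.finite_measure_mono) auto
    also have "\<dots> \<le> exp (- ?h\<^sup>2 * (rate / \<alpha>) / 3)"
    proof (rule chernoff_lower)
      have "p * (x / \<alpha>) \<le> p * card D" using 1 pr(2) by (intro mult_left_mono) auto
      moreover have "p * (x / \<alpha>) = rate / \<alpha>" by (simp add: pr(4)[symmetric])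
      ultimately show "rate / \<alpha> \<le> real (card D) * p" by (simp only: mult.commute[of p])
    qed (use B pr(2,3) eps_hat_bounds r eps in auto)
    also have "\<dots> \<le> exp (- log_factor)"
    proof -
      have "?h\<^sup>2 * (rate / \<alpha>) / 3 = ?h\<^sup>2 * rate / \<alpha> / 3" by simp
      also have "\<dots> = (1 + \<epsilon>) * log_factor / \<alpha>" unfolding rate_eq by (rule third)
      finally have "?h\<^sup>2 * (rate / \<alpha>) / 3 = (1 + \<epsilon>) * log_factor / \<alpha>" .
      moreover have "\<alpha> * log_factor \<le> (1 + \<epsilon>) * log_factor"
        using eps log_factor_ge[OF T] by (intro mult_right_mono) auto
      then have "log_factor \<le> (1 + \<epsilon>) * log_factor / \<alpha>"
        using pos_le_divide_eq[of \<alpha> log_factor "(1 + \<epsilon>) * log_factor"] eps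
        by (simp add: mult.commute[of log_factor])
      ultimately show ?thesis unfolding exp_le_cancel_iff by linarith
    qed
    finally show ?thesis using True by simp
  next
    case 2
    have eq: "(1 + ?h) * (rate / (1 + \<epsilon>)) = rate / (1 + 3 * \<epsilon> / 4)"
      unfolding eps_hat_plus by (rule cancel) (use eps in simp)
    have "?X \<subseteq> {f. (1 + ?h) * (rate / (1 + \<epsilon>)) \<le> ?N f}"
    proof
      fix f assume "f \<in> ?X"
      from X[OF this] show "f \<in> {f. (1 + ?h) * (rate / (1 + \<epsilon>)) \<le> ?N f}"
        unfolding mem_Collect_eq eq using 2 le by linarith
    qed
    then have "measure_pmf.prob ?P ?X \<le> measure_pmf.prob ?P {f. (1 + ?h) * (rate / (1 + \<epsilon>)) \<le> ?N f}"
      by (intro measure_pmf.finite_measure_mono) auto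
    also have "\<dots> \<le> exp (- ?h\<^sup>2 * (rate / (1 + \<epsilon>)) / 3)"
    proof (rule chernoff_upper)
      have "p * card D \<le> p * (x / (1 + \<epsilon>))" using 2 pr(2) by (intro mult_left_mono) auto
      moreover have "p * (x / (1 + \<epsilon>)) = rate / (1 + \<epsilon>)" by (simp add: pr(4)[symmetric])
      ultimately show "real (card D) * p \<le> rate / (1 + \<epsilon>)" by (simp only: mult.commute[of p])
    qed (use B pr(2,3) eps_hat_bounds in auto)
    also have "\<dots> \<le> exp (- log_factor)"
    proof -
      have "?h\<^sup>2 * (rate / (1 + \<epsilon>)) / 3 = ?h\<^sup>2 * rate / (1 + \<epsilon>) / 3" by simp
      also have "\<dots> = (1 + \<epsilon>) * log_factor / (1 + \<epsilon>)" unfolding rate_eq by (rule third)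
      also have "\<dots> = log_factor" using eps by simp
      finally show ?thesis unfolding exp_le_cancel_iff by linarith
    qed
    finally show ?thesis using True by simp
  next
    case 3
    then show ?thesis using True by simp
  qed
qed

section \<open>Which arcs a decision depends on\<close>

lemma appended_cong:
  assumes "\<And>w. (v, w) \<in> S i \<longleftrightarrow> (v, w) \<in> S' i"
  shows "appended \<Delta> S i H v = appended \<Delta> S' i H v"
  by (simp add: appended_def assms)

text \<open>The decision about a vertex reads only arcs that leave it, so processing a block of
  vertices reads only arcs that leave the block.\<close>

lemma fold_strip_cong:
  assumes "\<And>v w. v \<in> set vs \<Longrightarrow> (v, w) \<in> S i \<longleftrightarrow> (v, w) \<in> S' i"
  shows "fold (strip \<Delta> S i) vs H = fold (strip \<Delta> S' i) vs H"
  using assms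
proof (induction vs arbitrary: H)
  case (Cons v vs)
  have "strip \<Delta> S i v H = strip \<Delta> S' i v H"
    using appended_cong[of v S i S' \<Delta> H] Cons.prems by (simp add: strip_def)
  then show ?case using Cons by simp
qed simp

lemma active_at_cong:
  assumes "\<And>j. j < i \<Longrightarrow> S j = S' j"
  shows "active_at k U \<Delta> S i = active_at k U \<Delta> S' i"
  using assms
proof (induction i)
  case (Suc i)
  then have "fold (strip \<Delta> S i) vs H = fold (strip \<Delta> S' i) vs H" for vs H
    by (intro fold_strip_cong) simp
  then show ?case using Suc by simp
qed simp

lemma fold_strip_mem: "v \<in> H \<Longrightarrow> v \<notin> set vs \<Longrightarrow> v \<in> fold (strip \<Delta> S i) vs H"
  by (induction vs arbitrary: H) (auto simp: strip_def)

definition sample_space :: "'v set \<Rightarrow> real \<Rightarrow> (nat \<times> 'v \<times> 'v \<Rightarrow> bool) pmf" where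
  "sample_space U \<Delta> = Pi_pmf ({0..<q} \<times> arcs E U) False
     (\<lambda>x. bernoulli_pmf (level_prob n \<epsilon> \<delta> \<Delta> (fst x)))"

definition level_samples :: "(nat \<times> 'v \<times> 'v \<Rightarrow> bool) \<Rightarrow> nat \<Rightarrow> ('v \<times> 'v) set" where
  "level_samples f j = {a. f (j, a)}"

lemma finite_arcs: "U \<subseteq> V \<Longrightarrow> finite (arcs E U)"
  by (rule finite_subset[of _ "U \<times> U"]) (auto simp: arcs_def intro: finite_subset[OF _ finV])

text \<open>Deferred decisions: the sets that \<open>v\<close> meets in round \<open>i\<close> are determined by the arcs of
  earlier rounds and by the arcs that leave other vertices, so that the arcs leaving \<open>v\<close> can be
  drawn last.\<close>

lemma prob_misjudges:
  assumes T: "1 \<le> T" and U: "U \<subseteq> V" and i: "i < q" and \<Delta>: "0 < \<Delta>"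
  shows "measure_pmf.prob (sample_space U \<Delta>) {f. misjudges k U \<Delta> (level_samples f) i v}
    \<le> (if rate < level_bound \<epsilon> \<Delta> i then exp (- log_factor) else 0)" (is "_ \<le> ?b")
  unfolding sample_space_def
proof (rule prob_Pi_pmf_condition[where B = "{i} \<times> {a \<in> arcs E U. fst a = v}"])
  let ?A = "{0..<q} \<times> arcs E U" and ?B = "{i} \<times> {a \<in> arcs E U. fst a = v}"
  let ?p = "level_prob n \<epsilon> \<delta> \<Delta> i"
  show "finite ?A" "?B \<subseteq> ?A" using finite_arcs[OF U] i by auto
  fix g assume g: "\<forall>x. x \<notin> ?A - ?B \<longrightarrow> g x = False"
  let ?c = "\<lambda>f x. if x \<in> ?B then f x else g x"
  let ?W = "active_at k U \<Delta> (level_samples g) i"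
  have b: "0 \<le> ?b" by simp
  have act: "active_at k U \<Delta> (level_samples (?c f)) i = ?W" for f
    by (rule active_at_cong) (auto simp: level_samples_def)
  have WV: "?W \<subseteq> V" using active_at_subset U by blast
  have "measure_pmf.prob (Pi_pmf ?B False (\<lambda>x. bernoulli_pmf (level_prob n \<epsilon> \<delta> \<Delta> (fst x))))
      {f. misjudges k U \<Delta> (level_samples (?c f)) i v} =
    measure_pmf.prob (Pi_pmf ?B False (\<lambda>_. bernoulli_pmf ?p)) {f. misjudges k U \<Delta> (level_samples (?c f)) i v}"
    by (intro arg_cong2[where f = measure_pmf.prob] Pi_pmf_cong refl) (use finite_arcs[OF U] in auto)
  also have "\<dots> \<le> ?b"
  proof (cases "v \<in> set (enum k i ?W)")
    case False
    then have "{f. misjudges k U \<Delta> (level_samples (?c f)) i v} = {}" by (auto simp: misjudges_def act)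
    then show ?thesis using b by simp
  next
    case True
    then obtain ys zs where split: "enum k i ?W = ys @ v # zs" by (meson split_list)
    have v: "v \<notin> set ys" "v \<notin> set zs" using enum_distinct[OF WV, of k i] split by auto
    let ?H = "fold (strip \<Delta> (level_samples g) i) ys ?W"
    have "v \<in> ?W" using True enum_set[OF WV] by simp
    then have H: "?H \<subseteq> U" "v \<in> ?H"
      using order_trans[OF fold_strip_subset active_at_subset] fold_strip_mem v(1) by auto
    have fold: "fold (strip \<Delta> (level_samples (?c f)) i) ys ?W = ?H" for f
      by (rule fold_strip_cong) (use v in \<open>auto simp: level_samples_def\<close>)
    have mis: "misjudges k U \<Delta> (level_samples (?c f)) i v \<longleftrightarrow> misjudged \<Delta> (level_samples (?c f)) i ?H v" for f
      unfolding misjudges_def act split using fold v append_Cons_eq_iff[OF v] by auto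
    let ?D = "(\<lambda>w. (i, v, w)) ` {w \<in> ?H. {v, w} \<in> E}"
    have D: "?D \<subseteq> ?B" using H by (auto simp: arcs_def)
    have "card ?D = card {w \<in> ?H. {v, w} \<in> E}" by (rule card_image) (auto simp: inj_on_def)
    then have cardD: "card ?D = deg ?H v" using deg_in_eq_card[OF graph H(2)] by simp
    \<comment> \<open>A pair (v, w) that is no arc within \<open>U\<close> lies outside
      \<open>?A\<close>, where \<open>g\<close> is False; so nothing but edges of \<open>E\<close>
      inside \<open>?H\<close> is counted.\<close>
    have cnt: "card {w \<in> ?H. (v, w) \<in> level_samples (?c f) i} = card {y \<in> ?D. f y}" for f
    proof -
      have "{y \<in> ?D. f y} = (\<lambda>w. (i, v, w)) ` {w \<in> ?H. (v, w) \<in> level_samples (?c f) i}"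
        using g H i by (auto simp: level_samples_def arcs_def image_iff)
      then show ?thesis by (simp add: card_image inj_on_def)
    qed
    have fin: "finite ?B" using finite_arcs[OF U] by simp
    have lb: "0 < level_bound \<epsilon> \<Delta> i" using \<Delta> eps by (simp add: level_bound_def)
    show ?thesis
      using prob_estimate_misjudged[OF T fin D lb level_prob_eq]
      unfolding mis misjudged_def appended_def cnt cardD by simp
  qed
  finally show "measure_pmf.prob (Pi_pmf ?B False (\<lambda>x. bernoulli_pmf (level_prob n \<epsilon> \<delta> \<Delta> (fst x))))
      {f. misjudges k U \<Delta> (level_samples (?c f)) i v} \<le> ?b" .
qed

section \<open>The number of arcs sampled in one pass\<close>

lemma max_passes_pos: "1 \<le> max_passes"
proof -
  have "0 < T / q" using T_pos levels by simp
  then show ?thesis unfolding max_passes_def by linarith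
qed

lemma alpha_power_q: "\<alpha> ^ q \<le> real n powr c"
proof -
  have "real q \<le> log \<alpha> (real n powr c)" using levels unfolding num_levels_def by linarith
  then have "\<alpha> powr real q \<le> \<alpha> powr log \<alpha> (real n powr c)" using eps by (intro powr_mono) auto
  then show ?thesis using eps n_ge_2 by (simp add: powr_realpow)
qed

text \<open>A level has at most n \<Delta> arcs, each kept with probability at most rate *
  \<alpha>^j / \<Delta>, so \<Delta> cancels. The geometric sum over the levels costs
  \<open>\<alpha> ^ q\<close> \<le> n powr c and a factor 2 / \<epsilon>.\<close>

lemma prob_arcs_exceed:
  assumes U: "U \<subseteq> V" and \<Delta>: "0 < \<Delta>" and deg: "\<forall>u\<in>U. real (deg U u) \<le> \<Delta>"
  shows "measure_pmf.prob (sample_space U \<Delta>)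
    {f. \<not> real (\<Sum>j<q. card (level_samples f j)) \<le> arc_bound} \<le> \<delta> / (2 * max_passes)"
proof -
  let ?A = "{0..<q} \<times> arcs E U"
  let ?p = "\<lambda>x :: nat \<times> 'v \<times> 'v. min 1 (max 0 (level_prob n \<epsilon> \<delta> \<Delta> (fst x)))"
  let ?R = "max 0 rate" and ?Y = "ln (2 * real max_passes / \<delta>)"
  have fin: "finite ?A" using finite_arcs[OF U] by simp
  have finU: "finite U" using U finV finite_subset by blast
  \<comment> \<open>The sampling probability may be negative; clipping makes it a true probability,
    as the moment bound demands, without changing the distribution.\<close>
  have space: "sample_space U \<Delta> = Pi_pmf ?A False (\<lambda>x. bernoulli_pmf (?p x))"
    unfolding sample_space_def by (subst bernoulli_pmf_clip) simp
  have count: "(\<Sum>j<q. card (level_samples f j)) = card {x \<in> ?A. f x}"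
    if "f \<in> set_pmf (sample_space U \<Delta>)" for f
  proof -
    have out: "\<not> f x" if "x \<notin> ?A" for x
      using subsetD[OF set_Pi_pmf_subset[OF fin] \<open>f \<in> _\<close>[unfolded sample_space_def]] that by (cases x) auto
    then have "{x \<in> ?A. f x} = (SIGMA j:{..<q}. level_samples f j)"
      by (auto simp: level_samples_def)
    moreover have "finite (level_samples f j)" for j
      using out by (intro finite_subset[OF _ finite_arcs[OF U]]) (auto simp: level_samples_def)
    ultimately show ?thesis by simp
  qed
  have "card (arcs E U) \<le> real n * \<Delta>"
  proof -
    have "real (card (arcs E U)) = (\<Sum>u\<in>U. real (deg U u))" using card_arcs[OF graph finU] by simp
    also have "\<dots> \<le> (\<Sum>u\<in>U. \<Delta>)" using deg by (intro sum_mono) auto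
    also have "\<dots> \<le> real n * \<Delta>" using card_mono[OF finV U] \<Delta> by (simp add: mult_right_mono)
    finally show ?thesis .
  qed
  note arcs = this
  have clip: "min 1 (max 0 (min a 1)) \<le> b" if "a \<le> b" "0 \<le> b" for a b :: real
    using that by linarith
  have geometric: "(\<Sum>j<q. \<alpha> ^ j) = (\<alpha> ^ q - 1) / (\<epsilon> / 2)"
    using geometric_sum[of \<alpha> q] eps by simp
  \<comment> \<open>\<open>?p\<close> looks only at the level, so \<open>undefined\<close> can stand
    for any arc.\<close>
  have "(\<Sum>x\<in>?A. ?p x) = (\<Sum>j<q. card (arcs E U) * ?p (j, undefined))"
    by (simp add: sum.cartesian_product' atLeast0LessThan)
  also have "\<dots> \<le> (\<Sum>j<q. real n * ?R * \<alpha> ^ j)"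
  proof (intro sum_mono)
    fix j
    have "rate / level_bound \<epsilon> \<Delta> j \<le> ?R * \<alpha> ^ j / \<Delta>"
      using \<Delta> eps by (simp add: level_bound_def divide_right_mono mult_right_mono)
    then have "?p (j, undefined) \<le> ?R * \<alpha> ^ j / \<Delta>"
      unfolding level_prob_eq using \<Delta> eps by (intro clip) auto
    then have "card (arcs E U) * ?p (j, undefined) \<le> (real n * \<Delta>) * (?R * \<alpha> ^ j / \<Delta>)"
      using arcs \<Delta> by (intro mult_mono) auto
    then show "card (arcs E U) * ?p (j, undefined) \<le> real n * ?R * \<alpha> ^ j" using \<Delta> by simp
  qed
  also have "\<dots> = real n * ?R * ((\<alpha> ^ q - 1) / (\<epsilon> / 2))"
    by (simp only: sum_distrib_left[symmetric] geometric)
  also have "\<dots> \<le> real n * ?R * (real n powr c / (\<epsilon> / 2))"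
    using alpha_power_q eps by (intro mult_left_mono divide_right_mono) auto
  also have "\<dots> = 2 * (real n powr (1 + c) * ?R / \<epsilon>)"
    using n_ge_2 by (simp add: powr_add mult_ac)
  finally have mean: "(\<Sum>x\<in>?A. ?p x) \<le> 2 * (real n powr (1 + c) * ?R / \<epsilon>)" .
  have "measure_pmf.prob (sample_space U \<Delta>) {f. \<not> real (\<Sum>j<q. card (level_samples f j)) \<le> arc_bound}
    \<le> measure_pmf.prob (sample_space U \<Delta>) {f. 1 * arc_bound \<le> 1 * real (card {x \<in> ?A. f x})}"
    by (intro measure_pmf.finite_measure_mono_AE AE_pmfI) (auto simp: count simp del: of_nat_sum)
  also have "\<dots> \<le> exp (- 1 * arc_bound + (exp 1 - 1) * (\<Sum>x\<in>?A. ?p x))"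
    unfolding space by (rule bernoulli_chernoff_mgf[OF fin order_refl]) auto
  also have "\<dots> \<le> exp (- ?Y)"
  proof -
    have "(exp 1 - 1) * (\<Sum>x\<in>?A. ?p x) \<le> 2 * (2 * (real n powr (1 + c) * ?R / \<epsilon>))"
      using exp_le mean by (intro mult_mono) (auto intro!: sum_nonneg)
    then show ?thesis by (simp add: arc_bound_def)
  qed
  also have "\<dots> = \<delta> / (2 * max_passes)"
    using del max_passes_pos by (simp add: exp_minus)
  finally show ?thesis .
qed


section \<open>The main loop\<close>

abbreviation "loop \<equiv> dd_loop es enum n \<epsilon> \<delta> q"

lemma loop_done: "active s = {} \<Longrightarrow> loop s = return_spmf s"
  by (subst dd_loop.simps) simp

lemma loop_append_rest:
  assumes "active s \<noteq> {}" "current_bound \<epsilon> q s < 1"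
  shows "loop s = return_spmf (append_rest enum q s)"
proof -
  have "active (append_rest enum q s) = {}" by (simp add: append_rest_def charge_def)
  then have "loop (append_rest enum q s) = return_spmf (append_rest enum q s)" by (rule loop_done)
  then show ?thesis using assms by (subst dd_loop.simps) simp
qed

lemma loop_level_step:
  assumes "level s \<noteq> q"
  shows "loop s = loop (level_step s)"
proof -
  consider "active s = {}" | "active s \<noteq> {}" "current_bound \<epsilon> q s < 1"
    | "active s \<noteq> {}" "\<not> current_bound \<epsilon> q s < 1" by blast
  then show ?thesis
  proof cases
    case 2
    then show ?thesis by (subst dd_loop.simps) (simp add: level_step_def)
  next
    case 3
    then show ?thesis using assms
      by (subst dd_loop.simps) (simp add: level_step_def dd_round_def bind_return_pmf)
  qed (simp add: level_step_def)
qed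

text \<open>The round that scans also peels at level 0. Detaching the scan puts all randomness of a
  pass in front of q deterministic steps. The peel reappears as a \<open>level_step\<close>, since
  no exit test fires at level 0.\<close>

lemma loop_scan:
  assumes lev: "level s = q" and act: "active s \<noteq> {}" and bound: "1 \<le> deg_bound s"
  shows "loop s = bind_spmf (spmf_of_pmf (scan es n \<epsilon> \<delta> q s)) loop"
proof -
  let ?g = "\<lambda>s. next_level \<epsilon> q (peel enum n \<epsilon> \<delta> q s)"
  have "loop s = bind_spmf (spmf_of_pmf (map_pmf ?g (scan es n \<epsilon> \<delta> q s))) loop"
    using assms by (subst dd_loop.simps) (simp add: current_bound_def dd_round_def)
  also have "\<dots> = bind_pmf (scan es n \<epsilon> \<delta> q s) (\<lambda>s'. loop (?g s'))"
    by (simp only: bind_spmf_of_pmf bind_map_pmf)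
  also have "\<dots> = bind_pmf (scan es n \<epsilon> \<delta> q s) loop"
  proof (intro bind_pmf_cong refl)
    fix s' assume "s' \<in> set_pmf (scan es n \<epsilon> \<delta> q s)"
    then obtain S m where "s' = s\<lparr>sample := S, level := 0, passes := Suc (passes s), peak := m\<rparr>"
      by (rule scan_support)
    then have "active s' = active s" "level s' = 0" "deg_bound s' = deg_bound s" by simp_all
    moreover from this have "level_step s' = ?g s'"
      using levels act bound by (simp add: level_step_def current_bound_def level_bound_def)
    ultimately show "loop (?g s') = loop s'" using loop_level_step[of s'] levels by simp
  qed
  finally show ?thesis by simp
qed

lemma loop_level_steps:
  assumes "level_inv 0 k \<Delta> S U s" "m \<le> q"
    and "\<And>i v. 1 \<le> T \<Longrightarrow> i < q \<Longrightarrow> \<not> misjudges k U \<Delta> S i v"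
  shows "loop s = loop ((level_step ^^ m) s)"
  using assms(2)
proof (induction m)
  case (Suc m)
  let ?t = "(level_step ^^ m) s"
  have "finished k ?t \<or> level_inv m k \<Delta> S U ?t"
    using level_steps_inv[OF assms(1) _ assms(3), of m] Suc.prems by simp
  then have "active ?t = {} \<or> level ?t \<noteq> q"
    using Suc.prems by (auto simp: finished_def level_inv_def)
  moreover have "active ?t = {} \<Longrightarrow> level_step ?t = ?t" by (simp add: level_step_def)
  ultimately have "loop ?t = loop (level_step ?t)" using loop_level_step[of ?t] by auto
  then show ?case using Suc by simp
qed simp

section \<open>Rounds whose sampling probability is below 1\<close>

definition random_round :: "nat \<Rightarrow> bool" where
  "random_round t \<longleftrightarrow> 1 \<le> T \<and> rate < (real n - 1) / \<alpha> ^ t"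

text \<open>A budget: each such round costs \<delta> / (2 T), and this counts those that can still
  occur from pass k on, counting passes from 0.\<close>

definition random_rounds_from :: "nat \<Rightarrow> nat" where
  "random_rounds_from k = card {t. q * k \<le> t \<and> random_round t}"

text \<open>The bound of a random round exceeds \<open>rate\<close> \<ge> \<alpha>, so it stays
  above 1 even after another division by \<alpha>. This gains the round that keeps the total at T
  rather than T + 1.\<close>

lemma random_round_less:
  assumes "random_round t"
  shows "real t + 1 \<le> T"
proof -
  have T: "1 \<le> T" and "rate < (real n - 1) / \<alpha> ^ t" using assms by (auto simp: random_round_def)
  then have "\<alpha> < (real n - 1) / \<alpha> ^ t" using rate_ge by fastforce
  then have "\<alpha> ^ Suc t < real n" using eps by (simp add: pos_less_divide_eq)
  then have "\<alpha> powr real (Suc t) < real n" using eps by (subst powr_realpow) auto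
  then have "real (Suc t) < log \<alpha> (real n)"
    using eps n_ge_2 by (subst less_log_iff) auto
  then show ?thesis by (simp add: num_rounds_def)
qed

lemma random_rounds_bounded: "{t. random_round t} \<subseteq> {..<nat \<lfloor>T\<rfloor>}"
proof
  fix t assume "t \<in> {t. random_round t}"
  then have "real t + 1 \<le> T" using random_round_less by simp
  then have "int (Suc t) \<le> \<lfloor>T\<rfloor>" by (subst le_floor_iff) simp
  then show "t \<in> {..<nat \<lfloor>T\<rfloor>}" by auto
qed

lemma finite_random_rounds: "finite {t. random_round t}"
  using random_rounds_bounded finite_subset by blast

lemma random_rounds_le: "real (random_rounds_from 0) \<le> T"
proof -
  have "random_rounds_from 0 \<le> nat \<lfloor>T\<rfloor>"
    unfolding random_rounds_from_def using card_mono[OF _ random_rounds_bounded] by simp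
  then show ?thesis using T_pos by linarith
qed

lemma random_rounds_from_Suc:
  "random_rounds_from k = card {i. i < q \<and> random_round (q * k + i)} + random_rounds_from (Suc k)"
proof -
  let ?B = "(\<lambda>i. q * k + i) ` {i. i < q \<and> random_round (q * k + i)}"
  let ?C = "{t. q * Suc k \<le> t \<and> random_round t}"
  have "{t. q * k \<le> t \<and> random_round t} = ?B \<union> ?C"
  proof (intro equalityI subsetI)
    fix t assume t: "t \<in> {t. q * k \<le> t \<and> random_round t}"
    then have "t = q * k + (t - q * k)" by simp
    then show "t \<in> ?B \<union> ?C" using t by (cases "t - q * k < q") auto
  qed auto
  moreover have "?B \<inter> ?C = {}" by auto
  moreover have "finite ?C" using finite_random_rounds by (rule rev_finite_subset) auto
  ultimately have "random_rounds_from k = card ?B + card ?C"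
    unfolding random_rounds_from_def by (simp add: card_Un_disjoint)
  also have "card ?B = card {i. i < q \<and> random_round (q * k + i)}"
    by (rule card_image) (simp add: inj_on_def)
  finally show ?thesis by (simp add: random_rounds_from_def)
qed

text \<open>Union bound over q levels and at most n vertices: a random round costs n * \<delta> / (2
  n T), any other round nothing.\<close>

lemma prob_pass_misjudges:
  assumes U: "U \<subseteq> V" and \<Delta>: "\<Delta> = (real n - 1) / \<alpha> ^ (q * k)" "1 \<le> \<Delta>"
  shows "measure_pmf.prob (sample_space U \<Delta>)
      {f. 1 \<le> T \<and> (\<exists>i<q. \<exists>v\<in>U. misjudges k' U \<Delta> (level_samples f) i v)}
    \<le> real (card {i. i < q \<and> random_round (q * k + i)}) * (\<delta> / (2 * T))"
proof (cases "1 \<le> T")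
  case False
  then show ?thesis using T_pos del by simp
next
  case True
  let ?P = "sample_space U \<Delta>" and ?M = "\<lambda>i v. {f. misjudges k' U \<Delta> (level_samples f) i v}"
  have finU: "finite U" using U finV finite_subset by blast
  have "{f. 1 \<le> T \<and> (\<exists>i<q. \<exists>v\<in>U. misjudges k' U \<Delta> (level_samples f) i v)} = (\<Union>i\<in>{..<q}. \<Union>v\<in>U. ?M i v)"
    using True by auto
  also have "measure_pmf.prob ?P \<dots> \<le> (\<Sum>i<q. measure_pmf.prob ?P (\<Union>v\<in>U. ?M i v))"
    by (rule measure_pmf.finite_measure_subadditive_finite) auto
  also have "\<dots> \<le> (\<Sum>i<q. if random_round (q * k + i) then \<delta> / (2 * T) else 0)"
  proof (intro sum_mono)
    fix i assume "i \<in> {..<q}"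
    then have i: "i < q" by simp
    have rr: "random_round (q * k + i) \<longleftrightarrow> rate < level_bound \<epsilon> \<Delta> i"
      using True by (simp add: random_round_def level_bound_def \<Delta>(1) power_add)
    have "measure_pmf.prob ?P (\<Union>v\<in>U. ?M i v) \<le> (\<Sum>v\<in>U. measure_pmf.prob ?P (?M i v))"
      using finU by (intro measure_pmf.finite_measure_subadditive_finite) auto
    also have "\<dots> \<le> (\<Sum>v\<in>U. if random_round (q * k + i) then \<delta> / (2 * real n * T) else 0)"
      unfolding rr exp_minus_log_factor[symmetric] using \<Delta>(2)
      by (intro sum_mono prob_misjudges[OF True U i]) simp
    also have "\<dots> = real (card U) * (if random_round (q * k + i) then \<delta> / (2 * real n * T) else 0)"
      by simp
    also have "\<dots> \<le> real n * (if random_round (q * k + i) then \<delta> / (2 * real n * T) else 0)"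
      using card_mono[OF finV U] del T_pos by (intro mult_right_mono) auto
    also have "\<dots> = (if random_round (q * k + i) then \<delta> / (2 * T) else 0)"
      using n_ge_2 by simp
    finally show "measure_pmf.prob ?P (\<Union>v\<in>U. ?M i v) \<le> (if random_round (q * k + i) then \<delta> / (2 * T) else 0)" .
  qed
  also have "\<dots> = real (card {i. i < q \<and> random_round (q * k + i)}) * (\<delta> / (2 * T))"
    by (simp add: sum.If_cases Int_def)
  finally show ?thesis .
qed

text \<open>For T < 1 the degrees are known to obey the bound only at the start, where it is n - 1.
  That is enough: by \<open>pass_number_bound\<close> all later bounds are then below 1, so no
  further pass needs its arcs counted.\<close>

definition pass_inv :: "nat \<Rightarrow> 'v dd_state \<Rightarrow> bool" where
  "pass_inv k s \<longleftrightarrow> level s = q \<and> passes s = k \<and> deg_bound s = (real n - 1) / \<alpha> ^ (q * k) \<and>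
     rest s \<subseteq> V \<and> valid_list (order s) (active s) \<and> small s \<and>
     (1 \<le> T \<or> k = 0 \<longrightarrow> (\<forall>u\<in>active s. real (deg (active s) u) \<le> deg_bound s))"

lemma pass_inv_scan:
  assumes inv: "pass_inv k s" and s': "s' \<in> set_pmf (scan es n \<epsilon> \<delta> q s)"
    and deg: "\<forall>u\<in>active s. real (deg (active s) u) \<le> deg_bound s"
    and arcs: "real (\<Sum>j<q. card (sample s' j)) \<le> arc_bound"
  shows "level_inv 0 (Suc k) (deg_bound s) (sample s') (active s) s'"
proof -
  obtain S m where eq: "s' = s\<lparr>sample := S, level := 0, passes := Suc (passes s), peak := m\<rparr>"
    and m: "m \<le> max (peak s) (words q s')"
    using s' by (rule scan_support)
  have vl: "valid_list (order s) (active s)" "rest s \<subseteq> V" "active s \<subseteq> V" and sm: "small s"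
    using inv by (auto simp: pass_inv_def valid_list_def)
  \<comment> \<open>\<open>words_le\<close> presupposes a small peak, which is the goal here. It
    applies with the old peak put back, and \<open>words\<close> does not read that field.\<close>
  have "real (words q (s'\<lparr>peak := peak s\<rparr>)) \<le> peak_bound"
    by (rule words_le[where W = "active s"]) (use arcs sm vl eq in \<open>auto simp: small_def\<close>)
  moreover have "words q (s'\<lparr>peak := peak s\<rparr>) = words q s'" by (simp add: words_def)
  ultimately have "small s'" using m sm arcs eq by (auto simp: small_def max_def split: if_splits)
  then show ?thesis using inv levels eq vl deg by (simp add: level_inv_def pass_inv_def level_bound_def)
qed

lemma level_inv_pass_inv:
  assumes "level_inv q (Suc k) \<Delta> S U s" "\<Delta> = (real n - 1) / \<alpha> ^ (q * k)"
  shows "pass_inv (Suc k) s"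
proof -
  have d: "deg_bound s = (real n - 1) / \<alpha> ^ (q * Suc k)"
    using assms by (simp add: level_inv_def power_add mult.commute)
  have "level_bound \<epsilon> \<Delta> q = deg_bound s" using assms by (simp add: level_inv_def level_bound_def)
  with assms(1) d show ?thesis unfolding level_inv_def pass_inv_def by auto
qed

text \<open>A bound of at least 1 means \<open>\<alpha> ^ (q * k)\<close> < n, that is, q k <
  T.\<close>

lemma pass_number_bound:
  assumes "1 \<le> (real n - 1) / \<alpha> ^ (q * k)"
  shows "k < max_passes" "T < 1 \<Longrightarrow> k = 0"
proof -
  have "\<alpha> ^ (q * k) < real n" using assms eps by (simp add: pos_le_divide_eq)
  then have "\<alpha> powr real (q * k) < real n" using eps by (subst powr_realpow) auto
  then have qk: "real (q * k) < T"
    using eps n_ge_2 unfolding num_rounds_def by (subst less_log_iff) auto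
  have "real k < T / real q" using qk levels by (simp add: pos_less_divide_eq mult.commute)
  then show "k < max_passes" unfolding max_passes_def by linarith
  show "k = 0" if "T < 1"
  proof -
    have "q * k < 1" using qk that by linarith
    then show ?thesis using levels by simp
  qed
qed

lemma loop_finished: "finished k s \<Longrightarrow> k \<le> max_passes \<Longrightarrow>
    measure (measure_spmf (loop s)) {s. finished max_passes s} = 1"
  using loop_done[of s] by (auto simp: finished_def measure_measure_spmf_conv_measure_pmf)

lemma loop_early:
  assumes inv: "pass_inv k s" and k: "k \<le> max_passes"
    and early: "active s = {} \<or> deg_bound s < 1"
  shows "measure (measure_spmf (loop s)) {s. finished max_passes s} = 1"
proof (cases "active s = {}")
  case True
  then have "finished k s" using inv by (auto simp: finished_def pass_inv_def)
  then show ?thesis using k by (rule loop_finished)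
next
  case False
  then have b: "deg_bound s < 1" using early by simp
  have "\<forall>u\<in>active s. deg (active s) u = 0" if T: "1 \<le> T"
  proof
    fix u assume "u \<in> active s"
    then have "real (deg (active s) u) \<le> deg_bound s" using inv T unfolding pass_inv_def by blast
    then show "deg (active s) u = 0" using b by linarith
  qed
  then have fin: "finished max_passes (append_rest enum q s)"
    using inv k by (intro finished_append_rest) (auto simp: pass_inv_def)
  have "loop s = return_spmf (append_rest enum q s)"
    using False b inv by (intro loop_append_rest) (auto simp: current_bound_def pass_inv_def)
  then show ?thesis using fin by (simp add: measure_measure_spmf_conv_measure_pmf)
qed

text \<open>Unless the scan leads to a misjudgement or exceeds the arc bound, the q rounds after it
  end the run or reach the next \<open>pass_inv\<close>. The summands are the probabilities of these
  two events and the failure allowed to later passes.\<close>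

lemma loop_pass:
  assumes inv: "pass_inv k s" and act: "active s \<noteq> {}" and bound: "1 \<le> deg_bound s"
    and r: "0 \<le> r"
    and next_pass: "\<And>t. pass_inv (Suc k) t \<Longrightarrow> 1 - r \<le> measure (measure_spmf (loop t)) {s. finished max_passes s}"
  shows "1 - (real (card {i. i < q \<and> random_round (q * k + i)}) * (\<delta> / (2 * T)) + \<delta> / (2 * max_passes) + r)
    \<le> measure (measure_spmf (loop s)) {s. finished max_passes s}"
proof -
  let ?\<Delta> = "deg_bound s" and ?U = "active s" and ?X = "{s. finished max_passes s}"
  have \<Delta>: "?\<Delta> = (real n - 1) / \<alpha> ^ (q * k)" and lev: "level s = q" and U: "?U \<subseteq> V"
    using inv by (auto simp: pass_inv_def valid_list_def)
  have k: "Suc k \<le> max_passes" and "T < 1 \<Longrightarrow> k = 0"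
    using pass_number_bound[of k] bound \<Delta> by auto
  then have deg: "\<forall>u\<in>?U. real (deg ?U u) \<le> ?\<Delta>" using inv by (cases "1 \<le> T") (auto simp: pass_inv_def)
  define mis where "mis S \<longleftrightarrow> 1 \<le> T \<and> (\<exists>i<q. \<exists>v\<in>?U. misjudges (Suc k) ?U ?\<Delta> S i v)" for S
  define big where "big S \<longleftrightarrow> \<not> real (\<Sum>j<q. card (S j)) \<le> arc_bound" for S :: "nat \<Rightarrow> ('v \<times> 'v) set"
  have good: "1 - r \<le> measure (measure_spmf (loop s')) ?X"
    if s': "s' \<in> set_pmf (scan es n \<epsilon> \<delta> q s)" and nb: "\<not> (mis (sample s') \<or> big (sample s'))" for s'
  proof -
    have li: "level_inv 0 (Suc k) ?\<Delta> (sample s') ?U s'"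
      using nb by (intro pass_inv_scan[OF inv s' deg]) (simp add: big_def)
    \<comment> \<open>\<open>mis\<close> ranges over \<open>?U\<close> only, which keeps the union
      bound finite; other vertices are never enumerated.\<close>
    have nm: "\<not> misjudges (Suc k) ?U ?\<Delta> (sample s') i v" if "1 \<le> T" "i < q" for i v
    proof
      assume m: "misjudges (Suc k) ?U ?\<Delta> (sample s') i v"
      then have "v \<in> set (enum (Suc k) i (active_at (Suc k) ?U ?\<Delta> (sample s') i))"
        by (auto simp: misjudges_def)
      moreover have "active_at (Suc k) ?U ?\<Delta> (sample s') i \<subseteq> ?U" by (rule active_at_subset)
      ultimately have "v \<in> ?U" using U enum_set by blast
      then show False using m that nb by (auto simp: mis_def)
    qed
    let ?t = "(level_step ^^ q) s'"
    have "finished (Suc k) ?t \<or> level_inv q (Suc k) ?\<Delta> (sample s') ?U ?t"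
      using level_steps_inv[OF li order_refl nm] by blast
    moreover have "loop s' = loop ?t" using loop_level_steps[OF li order_refl nm] by blast
    ultimately show ?thesis
      using loop_finished[OF _ k] next_pass level_inv_pass_inv[OF _ \<Delta>] r by auto
  qed
  have bad: "measure_pmf.prob (scan es n \<epsilon> \<delta> q s) {s'. \<not> 1 - r \<le> measure (measure_spmf (loop s')) ?X}
    \<le> real (card {i. i < q \<and> random_round (q * k + i)}) * (\<delta> / (2 * T)) + \<delta> / (2 * max_passes)"
  proof -
    have "measure_pmf.prob (scan es n \<epsilon> \<delta> q s) {s'. \<not> 1 - r \<le> measure (measure_spmf (loop s')) ?X}
        \<le> measure_pmf.prob (scan es n \<epsilon> \<delta> q s) {s'. mis (sample s') \<or> big (sample s')}"
      by (intro measure_pmf.finite_measure_mono_AE AE_pmfI) (use good in auto)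
    also have "\<dots> = measure_pmf.prob (sample_space ?U ?\<Delta>)
        ({f. mis (level_samples f)} \<union> {f. big (level_samples f)})"
      by (simp only: Collect_disj_eq[symmetric] sample_space_def level_samples_def[abs_def]
          prob_scan[OF graph stream, where Q = "\<lambda>S. mis S \<or> big S"])
    also have "\<dots> \<le> measure_pmf.prob (sample_space ?U ?\<Delta>) {f. mis (level_samples f)}
        + measure_pmf.prob (sample_space ?U ?\<Delta>) {f. big (level_samples f)}"
      by (rule measure_Un_le) auto
    also have "\<dots> \<le> real (card {i. i < q \<and> random_round (q * k + i)}) * (\<delta> / (2 * T)) + \<delta> / (2 * max_passes)"
      unfolding mis_def big_def
      using prob_pass_misjudges[OF U \<Delta> bound] prob_arcs_exceed[OF U _ deg] bound
      by (intro add_mono) auto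
    finally show ?thesis .
  qed
  show ?thesis
    unfolding loop_scan[OF lev act bound] by (rule prob_bind_spmf_ge[OF bad r])
qed

text \<open>Induction on the number m of passes still available, with the random rounds to come as a
  second budget. At m = 0 the degree bound is below 1, so the loop ends without another
  pass.\<close>

lemma loop_success:
  assumes "pass_inv k s" "k + m = max_passes"
  shows "1 - (real (random_rounds_from k) * (\<delta> / (2 * T)) + real m * (\<delta> / (2 * max_passes)))
    \<le> measure (measure_spmf (loop s)) {s. finished max_passes s}"
  using assms
proof (induction m arbitrary: k s)
  case 0
  have "deg_bound s < 1"
    using 0 pass_number_bound(1)[of k] by (force simp: pass_inv_def)
  then have "measure (measure_spmf (loop s)) {s. finished max_passes s} = 1"
    using loop_early[OF 0(1)] 0(2) by simp
  then show ?case using del T_pos by simp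
next
  case (Suc m)
  let ?r = "real (random_rounds_from (Suc k)) * (\<delta> / (2 * T)) + real m * (\<delta> / (2 * max_passes))"
  have r: "0 \<le> ?r" using del T_pos by (intro add_nonneg_nonneg mult_nonneg_nonneg) auto
  show ?case
  proof (cases "active s = {} \<or> deg_bound s < 1")
    case True
    then have "measure (measure_spmf (loop s)) {s. finished max_passes s} = 1"
      using loop_early[OF Suc.prems(1)] Suc.prems(2) by simp
    moreover have "0 \<le> real (random_rounds_from k) * (\<delta> / (2 * T)) + real (Suc m) * (\<delta> / (2 * max_passes))"
      using del T_pos by (intro add_nonneg_nonneg mult_nonneg_nonneg) auto
    ultimately show ?thesis by linarith
  next
    case False
    have "1 - (real (card {i. i < q \<and> random_round (q * k + i)}) * (\<delta> / (2 * T)) + \<delta> / (2 * max_passes) + ?r)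
      \<le> measure (measure_spmf (loop s)) {s. finished max_passes s}"
    proof (rule loop_pass[OF Suc.prems(1) _ _ r])
      fix t assume "pass_inv (Suc k) t"
      then show "1 - ?r \<le> measure (measure_spmf (loop t)) {s. finished max_passes s}"
        using Suc.IH Suc.prems(2) by simp
    qed (use False in auto)
    moreover have "real (card {i. i < q \<and> random_round (q * k + i)}) * (\<delta> / (2 * T)) + \<delta> / (2 * max_passes) + ?r
      = real (random_rounds_from k) * (\<delta> / (2 * T)) + real (Suc m) * (\<delta> / (2 * max_passes))"
      unfolding random_rounds_from_Suc[of k] of_nat_add of_nat_Suc by (simp only: distrib_right mult_1 add_ac)
    ultimately show ?thesis by simp
  qed
qed

lemma arc_bound_nonneg: "0 \<le> arc_bound"
proof -
  have "\<delta> \<le> 2 * real max_passes" using del max_passes_pos by linarith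
  then have "1 \<le> 2 * real max_passes / \<delta>" using del by simp
  then have "0 \<le> ln (2 * real max_passes / \<delta>)" by simp
  then show ?thesis unfolding arc_bound_def using eps by (intro add_nonneg_nonneg) auto
qed

lemma pass_inv_init: "pass_inv 0 (dd_init V q)"
proof -
  let ?s = "\<lparr>order = [], active = V, rest = {}, deg_bound = real n - 1, level = q,
      sample = (\<lambda>_. {}), passes = 0, peak = 0\<rparr> :: 'v dd_state"
  have "small ?s" using arc_bound_nonneg by (simp add: small_def peak_bound_def)
  moreover have vl: "valid_list [] V" by (simp add: valid_list_def dd_prefix_def)
  ultimately have sm: "small (dd_init V q)" unfolding dd_init_def
    by (intro small_charge[where W = V]) auto
  have "real (deg V u) \<le> real n - 1" if "u \<in> V" for u
    using deg_in_less_card[OF graph that finV] by linarith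
  then show ?thesis using sm vl by (simp add: pass_inv_def dd_init_def charge_def)
qed

lemma algorithm_success:
  "1 - \<delta> \<le> measure (measure_spmf (dd_algorithm V es enum \<epsilon> \<delta> c)) {s. finished max_passes s}"
proof -
  have "real (random_rounds_from 0) * (\<delta> / (2 * T)) \<le> T * (\<delta> / (2 * T))"
    using random_rounds_le del T_pos by (intro mult_right_mono) auto
  also have "\<dots> = \<delta> / 2" using T_pos by simp
  finally have 1: "real (random_rounds_from 0) * (\<delta> / (2 * T)) \<le> \<delta> / 2" .
  have 2: "real max_passes * (\<delta> / (2 * max_passes)) = \<delta> / 2" using max_passes_pos by simp
  show ?thesis
    using loop_success[OF pass_inv_init, of max_passes] 1 2
    by (simp only: dd_algorithm_def Let_def add_0) linarith
qed

lemma finished_dd_order: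
  assumes "finished k s"
  shows "dd_order \<theta> V E (list_order (order s))"
proof -
  have V: "set (order s) = V" "distinct (order s)" and dd: "1 \<le> T \<Longrightarrow> dd_prefix \<theta> V E (order s)"
    using assms by (auto simp: finished_def valid_list_def)
  have "dd_prefix \<theta> V E (order s)"
  proof (cases "1 \<le> T")
    case False
    then have "real n < \<alpha>" using eps n_ge_2 by (simp add: num_rounds_def)
    then have "\<theta> * real n \<le> 1" using eps by simp
    then show ?thesis
      using eps by (auto simp: dd_prefix_def intro!: dominates_of_le_one[OF graph])
  qed (rule dd)
  then show ?thesis using dd_order_list_order[of "order s" \<theta> E] V by simp
qed


section \<open>Resource bounds\<close>

text \<open>From q = floor (c T) \<ge> 1 follows c T < q + 1 \<le> 2 q, hence T / q < 2 / c, and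
  rounding up adds less than 1. That addition calls for the maximum with 1: one pass is made however
  large c is.\<close>

lemma max_passes_le: "real max_passes \<le> 3 * max 1 (1 / c)"
proof -
  have q: "q = nat \<lfloor>c * T\<rfloor>" using n_ge_2 by (simp add: num_levels_def num_rounds_def log_powr)
  have "1 \<le> real q" using levels by linarith
  then have "c * T < 2 * real q" using q by linarith
  then have "T / q < 2 / c" using levels c by (simp add: field_simps)
  moreover have "0 < T / q" using T_pos levels by simp
  ultimately have "real max_passes < 2 / c + 1" unfolding max_passes_def by linarith
  moreover have "2 / c = 2 * (1 / c)" by simp
  ultimately show ?thesis by linarith
qed

text \<open>ln (1 + x) \<ge> x - x^2 at x = min 1 \<epsilon> / 2; the minimum cuts off large
  \<epsilon>, where no linear lower bound can hold.\<close>

lemma ln_alpha_ge: "min 1 \<epsilon> / 4 \<le> ln \<alpha>"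
proof -
  let ?e = "min 1 \<epsilon>"
  have e: "0 < ?e" "?e \<le> 1" "?e \<le> \<epsilon>" using eps by auto
  have "?e * ?e \<le> ?e * 1" using e by (intro mult_left_mono) auto
  then have "?e / 4 \<le> ?e / 2 - (?e / 2)\<^sup>2" by (simp add: power2_eq_square)
  also have "\<dots> \<le> ln (1 + ?e / 2)" using e by (intro ln_one_plus_pos_lower_bound) auto
  also have "\<dots> \<le> ln \<alpha>" using e by (intro ln_mono) auto
  finally show ?thesis .
qed

lemma ln_div_ln_alpha_le:
  assumes "0 < x"
  shows "ln x / ln \<alpha> \<le> 4 * x / min 1 \<epsilon>"
proof -
  let ?e = "min 1 \<epsilon>"
  have e: "0 < ?e" using eps by auto
  then have pos: "0 < ln \<alpha>" using ln_alpha_ge by linarith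
  have "ln x / ln \<alpha> \<le> x / ln \<alpha>"
    using ln_less_self[OF assms] pos by (intro divide_right_mono) auto
  also have "\<dots> \<le> x / (?e / 4)"
    using assms e ln_alpha_ge pos by (intro divide_left_mono) auto
  finally show ?thesis by (simp add: mult.commute)
qed

text \<open>294 = 3 * 2 * 7^2, from (1 + \<epsilon>) / \<epsilon> \<le> 2 / min 1 \<epsilon> and 1 /
  \<open>eps_hat \<epsilon>\<close> \<le> 7 / min 1 \<epsilon>. Two of the three powers of 1 /
  \<epsilon> are the price of accuracy \<open>eps_hat\<close>, the third comes from the geometric
  sum over the levels.\<close>

lemma rate_coefficient_le: "3 * (1 + \<epsilon>) / (eps_hat \<epsilon>)\<^sup>2 / \<epsilon> \<le> 294 / min 1 \<epsilon> ^ 3"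
proof -
  let ?e = "min 1 \<epsilon>"
  have e: "0 < ?e" "?e \<le> 1" "?e \<le> \<epsilon>" using eps by auto
  have inv: "1 / \<epsilon> \<le> 1 / ?e" "1 \<le> 1 / ?e" using e by (auto intro!: divide_left_mono)
  have "(1 + \<epsilon>) / \<epsilon> = 1 / \<epsilon> + 1" "(4 + 3 * \<epsilon>) / \<epsilon> = 4 * (1 / \<epsilon>) + 3"
    using eps by (simp_all add: add_divide_distrib)
  moreover have "2 / ?e = 2 * (1 / ?e)" "7 / ?e = 7 * (1 / ?e)" by simp_all
  ultimately have a: "(1 + \<epsilon>) / \<epsilon> \<le> 2 / ?e" and b: "(4 + 3 * \<epsilon>) / \<epsilon> \<le> 7 / ?e"
    using inv by linarith+
  have "3 * (1 + \<epsilon>) / (eps_hat \<epsilon>)\<^sup>2 / \<epsilon> = 3 * ((1 + \<epsilon>) / \<epsilon>) * ((4 + 3 * \<epsilon>) / \<epsilon>)\<^sup>2"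
    using eps by (simp add: eps_hat_def power_divide)
  also have "\<dots> \<le> 3 * (2 / ?e) * (7 / ?e)\<^sup>2"
    using a b e eps by (intro mult_mono power_mono) auto
  also have "\<dots> = 294 / ?e ^ 3" by (simp add: power2_eq_square power3_eq_cube)
  finally show ?thesis .
qed

text \<open>Every summand is compared with X ln z. As z \<ge> 2, ln z is at least 1/2, so terms
  without a logarithm fit as well.\<close>

lemma peak_bound_le:
  "peak_bound \<le> 20000 * (real n powr (1 + c) / min 1 \<epsilon> ^ 3 * ln (real n / (min 1 \<epsilon> * \<delta>)))"
proof -
  let ?e = "min 1 \<epsilon>"
  define z where "z = real n / (?e * \<delta>)"
  define X where "X = real n powr (1 + c) / ?e ^ 3"
  have e: "0 < ?e" "?e \<le> 1" using eps by auto
  have n: "2 \<le> real n" using n_ge_2 by simp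
  have e3: "0 < ?e ^ 3" "?e ^ 3 \<le> ?e" "?e ^ 3 \<le> 1"
    using e power_decreasing[of 1 3 ?e] power_le_one[of ?e 3] by auto
  have ed: "0 < ?e * \<delta>" "?e * \<delta> \<le> 1" using e del by (auto intro: mult_le_one)
  have nz: "real n \<le> z" unfolding z_def using n ed by (simp add: pos_le_divide_eq mult_left_le)
  have nez: "real n / ?e \<le> \<delta> * z" unfolding z_def using del by simp
  \<comment> \<open>The arguments of the two logarithms to come are at most 8 z^2 and 10 z. With z
    \<ge> 2, the fifth power of z covers both, by 8 \<le> z^3 and 10 \<le> z^4.\<close>
  have z2: "2 \<le> z" using n nz by linarith
  have z5: "10 * z \<le> z ^ 5" "8 * z\<^sup>2 \<le> z ^ 5"
  proof -
    have "2 ^ 4 \<le> z ^ 4" "2 ^ 3 \<le> z ^ 3" using z2 by (intro power_mono; simp)+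
    then have "10 * z \<le> z ^ 4 * z" "8 * z\<^sup>2 \<le> z ^ 3 * z\<^sup>2" using z2 by (intro mult_right_mono; simp)+
    then show "10 * z \<le> z ^ 5" "8 * z\<^sup>2 \<le> z ^ 5" by (simp_all add: eval_nat_numeral mult_ac)
  qed
  have lnz5: "ln a \<le> 5 * ln z" if "0 < a" "a \<le> z ^ 5" for a
  proof -
    have "ln a \<le> ln (z ^ 5)" using that by (intro ln_mono) auto
    also have "\<dots> = 5 * ln z" using z2 by (simp add: ln_realpow)
    finally show ?thesis .
  qed
  have half: "1 / 2 \<le> ln z"
  proof -
    have "ln 2 \<le> ln z" using z2 by (intro ln_mono) auto
    then show ?thesis using ln2_ge_two_thirds by linarith
  qed
  have nX: "real n \<le> X"
  proof -
    have "real n powr 1 \<le> real n powr (1 + c)" using n c by (intro powr_mono) auto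
    also have "\<dots> \<le> X" unfolding X_def using e3 by (simp add: pos_le_divide_eq mult_left_le)
    finally show ?thesis using n by simp
  qed
  then have XL: "X \<le> 2 * (X * ln z)" using half n mult_left_mono[of "1 / 2" "ln z" X] by simp
  have ln_le: "ln z \<le> X * ln z" using nX n half by simp
  have T: "T \<le> 4 * real n / ?e"
    unfolding num_rounds_def log_def using ln_div_ln_alpha_le n by simp
  have logf: "log_factor \<le> 5 * ln z"
  proof -
    have "2 * real n * T / \<delta> \<le> 2 * real n * (4 * real n / ?e) / \<delta>"
      using T del n by (intro divide_right_mono mult_left_mono) auto
    also have "\<dots> = 8 * (real n * z)" by (simp add: z_def)
    also have "\<dots> \<le> 8 * z\<^sup>2" using nz n by (simp add: power2_eq_square mult_right_mono)
    finally have "2 * real n * T / \<delta> \<le> z ^ 5" using z5 by linarith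
    moreover have "0 < 2 * real n * T / \<delta>" using n T_pos del by simp
    ultimately show ?thesis unfolding log_factor_def by (rule lnz5[rotated])
  qed
  have passes: "ln (2 * real max_passes / \<delta>) \<le> 5 * ln z"
  proof -
    have "T / q \<le> T / 1" using T_pos levels by (intro divide_left_mono) auto
    then have "real max_passes \<le> T + 1" unfolding max_passes_def using T_pos by linarith
    also have "\<dots> \<le> 4 * real n / ?e + real n / ?e"
    proof -
      have "1 * ?e \<le> real n" using e n by simp
      then have "1 \<le> real n / ?e" using e by (simp add: pos_le_divide_eq)
      then show ?thesis using T by linarith
    qed
    also have "\<dots> = 5 * (real n / ?e)" by simp
    also have "\<dots> \<le> 5 * (\<delta> * z)" using nez by simp
    finally have "2 * real max_passes / \<delta> \<le> 10 * z" using del by (simp add: pos_divide_le_eq mult_ac)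
    then have "2 * real max_passes / \<delta> \<le> z ^ 5" using z5 by linarith
    moreover have "0 < 2 * real max_passes / \<delta>" using max_passes_pos del by simp
    ultimately show ?thesis by (rule lnz5[rotated])
  qed
  have rate: "real n powr (1 + c) * max 0 rate / \<epsilon> \<le> 1470 * (X * ln z)"
  proof -
    let ?k = "3 * (1 + \<epsilon>) / (eps_hat \<epsilon>)\<^sup>2"
    have k: "0 \<le> ?k" using eps by simp
    have "?k * log_factor \<le> ?k * (5 * ln z)" using logf k by (intro mult_left_mono) auto
    moreover have "0 \<le> ?k * (5 * ln z)" using k half by (intro mult_nonneg_nonneg) auto
    ultimately have "max 0 rate \<le> ?k * (5 * ln z)" by (simp only: rate_def max.bounded_iff)
    then have "max 0 rate / \<epsilon> \<le> ?k * (5 * ln z) / \<epsilon>" using eps by (intro divide_right_mono) auto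
    also have "\<dots> = ?k / \<epsilon> * (5 * ln z)" by simp
    also have "\<dots> \<le> 294 / ?e ^ 3 * (5 * ln z)"
      using rate_coefficient_le half by (intro mult_right_mono) auto
    finally have "real n powr (1 + c) * (max 0 rate / \<epsilon>) \<le> real n powr (1 + c) * (294 / ?e ^ 3 * (5 * ln z))"
      by (intro mult_left_mono) auto
    then show ?thesis by (simp add: X_def mult_ac)
  qed
  have arcs: "arc_bound \<le> 5885 * (X * ln z)"
    unfolding arc_bound_def using rate passes ln_le by linarith
  have q: "real q \<le> 4 * X"
  proof -
    have "real q \<le> log \<alpha> (real n powr c)" using levels unfolding num_levels_def by linarith
    also have "\<dots> \<le> 4 * real n powr c / ?e"
      unfolding log_def by (rule ln_div_ln_alpha_le) (use n in simp)
    also have "\<dots> \<le> 4 * X"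
    proof -
      have "real n powr c \<le> real n powr (1 + c)" using n by (intro powr_mono) auto
      then have "real n powr c / ?e \<le> real n powr (1 + c) / ?e ^ 3" using e e3 by (intro frac_le) auto
      then show ?thesis by (simp add: X_def)
    qed
    finally show ?thesis .
  qed
  \<comment> \<open>In units of X ln z: 2 * 5885 for the arcs, 6 for 3 n, 16 for 2 q, and 16 for the
    constant, which is at most 8 n. The total 11808 leaves ample slack.\<close>
  have "peak_bound \<le> 20000 * (X * ln z)"
    unfolding peak_bound_def using arcs q nX XL n by linarith
  then show ?thesis unfolding X_def z_def .
qed

end

theorem theorem4:
  shows "\<exists>C > 0. \<forall>(V :: nat set) E es enum (\<epsilon> :: real) (\<delta> :: real) (c :: real).
    simple_graph V E \<longrightarrow> edge_stream E es \<longrightarrow> vertex_enumeration V enum \<longrightarrow>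
    0 < \<epsilon> \<longrightarrow> 0 < \<delta> \<longrightarrow> \<delta> < 1 \<longrightarrow> 0 < c \<longrightarrow> 1 \<le> num_levels (card V) \<epsilon> c \<longrightarrow>
    measure (measure_spmf (dd_algorithm V es enum \<epsilon> \<delta> c))
      {s. dd_order (1 / (1 + \<epsilon>)) V E (list_order (order s)) \<and>
          real (passes s) \<le> C * max 1 (1 / c) \<and>
          real (peak s) \<le> C * (real (card V) powr (1 + c) / min 1 \<epsilon> ^ 3
                                * ln (real (card V) / (min 1 \<epsilon> * \<delta>)))}
      \<ge> 1 - \<delta>"
proof (intro exI[of _ 20000] conjI allI impI)
  fix V :: "nat set" and E es enum and \<epsilon> \<delta> c :: real
  assume "simple_graph V E" "edge_stream E es" "vertex_enumeration V enum"
    "0 < \<epsilon>" "0 < \<delta>" "\<delta> < 1" "0 < c" "1 \<le> num_levels (card V) \<epsilon> c"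
  then interpret dd_instance V E es enum \<epsilon> \<delta> c by unfold_locales
  let ?X = "{s. dd_order (1 / (1 + \<epsilon>)) V E (list_order (order s)) \<and>
          real (passes s) \<le> 20000 * max 1 (1 / c) \<and>
          real (peak s) \<le> 20000 * (real (card V) powr (1 + c) / min 1 \<epsilon> ^ 3
                                * ln (real (card V) / (min 1 \<epsilon> * \<delta>)))}"
  \<comment> \<open>All randomness is dealt with in \<open>algorithm_success\<close>; the three
    requirements follow from \<open>finished\<close> deterministically.\<close>
  have "{s. finished max_passes s} \<subseteq> ?X"
  proof
    fix s assume "s \<in> {s. finished max_passes s}"
    then have fin: "finished max_passes s" by simp
    then have "real (passes s) \<le> real max_passes" "real (peak s) \<le> peak_bound"
      by (simp_all add: finished_def small_def)
    then have "real (passes s) \<le> 20000 * max 1 (1 / c)"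
      "real (peak s) \<le> 20000 * (real (card V) powr (1 + c) / min 1 \<epsilon> ^ 3
          * ln (real (card V) / (min 1 \<epsilon> * \<delta>)))"
      using max_passes_le peak_bound_le by linarith+
    then show "s \<in> ?X" using finished_dd_order[OF fin] by blast
  qed
  then have "measure (measure_spmf (dd_algorithm V es enum \<epsilon> \<delta> c)) {s. finished max_passes s}
      \<le> measure (measure_spmf (dd_algorithm V es enum \<epsilon> \<delta> c)) ?X"
    by (intro measure_spmf.finite_measure_mono) auto
  then show "1 - \<delta> \<le> measure (measure_spmf (dd_algorithm V es enum \<epsilon> \<delta> c)) ?X"
    using algorithm_success by linarith
qed simp

end
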